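(* Let $\phi=\tilde p/p$ be a rational inner function on $\mathbb{D}^2$ with $\deg p=(m,n)$, and let $0<\mathfrak p<\infty$. If $\frac{\partial\phi}{\partial z_1}\in H^{\mathfrak p}(\mathbb{D}^2)$, then $\phi\in\mathfrak{D}_{(\mathfrak p,0)}$; and if $\frac{\partial\phi}{\partial z_2}\in H^{\mathfrak p}(\mathbb{D}^2)$, then $\phi\in\mathfrak{D}_{(0,\mathfrak p)}$.
   Context: $\phi=\tilde p/p$ where $p\in\mathbb{C}[z_1,z_2]$ has bidegree $(m,n)$, no zeros in $\mathbb{D}^2$, is atoral, and $\tilde p(z)=z_1^mz_2^n\overline{p(1/\bar z_1,1/\bar z_2)}$. $H^{\mathfrak p}(\mathbb{D}^2)$: holomorphic $f$ with $\sup_{0<r<1}\frac1{4\pi^2}\int_{\mathbb{T}^2}|f(r\zeta)|^{\mathfrak p}|d\zeta|<\infty$. For $\vec\alpha=(\alpha_1,\alpha_2)\in\mathbb{R}^2$, the anisotropic Dirichlet-type space $\mathfrak D_{\vec\alpha}$ consists of holomorphic $f(z)=\sum_{k,\ell\ge0}a_{k\ell}z_1^kz_2^\ell$ on $\mathbb{D}^2$ with $\|f\|^2_{\mathfrak D_{\vec\alpha}}=\sum_{k,\ell\ge0}(k+1)^{\alpha_1}(\ell+1)^{\alpha_2}|a_{k\ell}|^2<\infty$. *)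

theory Defs
  imports "HOL-Analysis.Analysis"
begin

definition bipoly :: "(nat \<Rightarrow> nat \<Rightarrow> complex) \<Rightarrow> nat \<Rightarrow> nat \<Rightarrow> complex \<Rightarrow> complex \<Rightarrow> complex" where
  "bipoly c m n z1 z2 = (\<Sum>j\<le>m. \<Sum>k\<le>n. c j k * z1 ^ j * z2 ^ k)"

definition has_bidegree :: "(nat \<Rightarrow> nat \<Rightarrow> complex) \<Rightarrow> nat \<Rightarrow> nat \<Rightarrow> bool" where
  "has_bidegree c m n \<longleftrightarrow>
     (\<forall>j k. (m < j \<or> n < k) \<longrightarrow> c j k = 0) \<and> (\<exists>k. c m k \<noteq> 0) \<and> (\<exists>j. c j n \<noteq> 0)"

text \<open>Coefficients of the reflection p~(z) = z1^m z2^n conj(p(1/conj z1, 1/conj z2)).\<close>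
definition refl_coeff :: "(nat \<Rightarrow> nat \<Rightarrow> complex) \<Rightarrow> nat \<Rightarrow> nat \<Rightarrow> nat \<Rightarrow> nat \<Rightarrow> complex" where
  "refl_coeff c m n j k = (if j \<le> m \<and> k \<le> n then cnj (c (m - j) (n - k)) else 0)"

definition is_polyfun :: "(complex \<Rightarrow> complex \<Rightarrow> complex) \<Rightarrow> bool" where
  "is_polyfun f \<longleftrightarrow> (\<exists>d N. \<forall>z1 z2. f z1 z2 = bipoly d N N z1 z2)"

definition atoral :: "(nat \<Rightarrow> nat \<Rightarrow> complex) \<Rightarrow> nat \<Rightarrow> nat \<Rightarrow> bool" where
  "atoral c m n \<longleftrightarrow> \<not> (\<exists>q r s. is_polyfun q \<and> is_polyfun r \<and> is_polyfun s \<and>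
      \<not> (\<exists>a. \<forall>z1 z2. q z1 z2 = a) \<and>
      (\<forall>z1 z2. bipoly c m n z1 z2 = q z1 z2 * r z1 z2) \<and>
      (\<forall>z1 z2. bipoly (refl_coeff c m n) m n z1 z2 = q z1 z2 * s z1 z2))"

definition no_zeros_bidisc :: "(nat \<Rightarrow> nat \<Rightarrow> complex) \<Rightarrow> nat \<Rightarrow> nat \<Rightarrow> bool" where
  "no_zeros_bidisc c m n \<longleftrightarrow> (\<forall>z1 z2. norm z1 < 1 \<longrightarrow> norm z2 < 1 \<longrightarrow> bipoly c m n z1 z2 \<noteq> 0)"

definition holo_bidisc :: "(complex \<Rightarrow> complex \<Rightarrow> complex) \<Rightarrow> bool" where
  "holo_bidisc f \<longleftrightarrow> continuous_on (ball 0 1 \<times> ball 0 1) (\<lambda>(z, w). f z w) \<and>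
     (\<forall>w\<in>ball 0 1. (\<lambda>z. f z w) holomorphic_on ball 0 1) \<and>
     (\<forall>z\<in>ball 0 1. (\<lambda>w. f z w) holomorphic_on ball 0 1)"

definition hardy2 :: "real \<Rightarrow> (complex \<Rightarrow> complex \<Rightarrow> complex) \<Rightarrow> bool" where
  "hardy2 P f \<longleftrightarrow> holo_bidisc f \<and>
     bdd_above ((\<lambda>r. (1 / (4 * pi ^ 2)) *
        (LBINT s=0..2*pi. (LBINT t=0..2*pi.
            norm (f (of_real r * cis s) (of_real r * cis t)) powr P))) ` {0<..<1})"

definition taylor2 :: "(complex \<Rightarrow> complex \<Rightarrow> complex) \<Rightarrow> nat \<Rightarrow> nat \<Rightarrow> complex" where
  "taylor2 f k l = (deriv ^^ k) (\<lambda>z1. (deriv ^^ l) (\<lambda>z2. f z1 z2) 0) 0 / (fact k * fact l)"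

definition dirichlet2 :: "real \<Rightarrow> real \<Rightarrow> (complex \<Rightarrow> complex \<Rightarrow> complex) \<Rightarrow> bool" where
  "dirichlet2 a1 a2 f \<longleftrightarrow> holo_bidisc f \<and>
     (\<lambda>(k, l). (real k + 1) powr a1 * (real l + 1) powr a2 * (norm (taylor2 f k l))\<^sup>2)
        summable_on (UNIV :: (nat \<times> nat) set)"

definition d1 :: "(complex \<Rightarrow> complex \<Rightarrow> complex) \<Rightarrow> complex \<Rightarrow> complex \<Rightarrow> complex" where
  "d1 f z1 z2 = deriv (\<lambda>w. f w z2) z1"

definition d2 :: "(complex \<Rightarrow> complex \<Rightarrow> complex) \<Rightarrow> complex \<Rightarrow> complex \<Rightarrow> complex" where
  "d2 f z1 z2 = deriv (\<lambda>w. f z1 w) z2"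

end

(*
  For eta on the unit circle the slice phi(., eta) is, up to a unimodular constant, a finite Blaschke
  product B of degree at most m, say B(z) = sum b_k z^k.  Let eps be the distance of its zeros to the
  circle.  On the disc of radius R = 1 + eps/2 the function B is bounded in terms of m, and so is the
  integral of |(z B)'| over the circle of radius R; by Parseval's identity so is the sum of
  (k+1) |b_k|^2 R^(2k), and the sum of (k+1)^p |b_k|^2 is at most a constant times eps^(-max(0,p-1)).
  Conversely, on the unit circle |B'| is the sum of the Poisson kernels of the zeros, which is at least
  1/(4 eps) on an arc of length eps; therefore eps^(1-p) is at most 4^p times the integral of |B'|^p.
  Integrating over eta (Parseval in the second variable, Fatou for the radial limits) gives the claim
  for d/dz_1, and the claim for d/dz_2 follows by exchanging the variables.
*)
theory Submission
  imports Defs "HOL-Complex_Analysis.Complex_Analysis"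
    "HOL-Computational_Algebra.Fundamental_Theorem_Algebra"
begin

subsection \<open>Taylor coefficients and Parseval's identity\<close>

definition taylor_coeff :: "(complex \<Rightarrow> complex) \<Rightarrow> nat \<Rightarrow> complex" where
  "taylor_coeff f k = (deriv ^^ k) f 0 / fact k"

lemma taylor_coeff_cong:
  assumes "eventually (\<lambda>z. f z = g z) (nhds 0)"
  shows "taylor_coeff f k = taylor_coeff g k"
  unfolding taylor_coeff_def using higher_deriv_cong_ev[OF assms refl] by simp

lemma taylor_coeff_cmult:
  assumes "f analytic_on {0}"
  shows "taylor_coeff (\<lambda>z. c * f z) k = c * taylor_coeff f k"
  unfolding taylor_coeff_def using higher_deriv_cmult'[OF assms] by simp

lemma taylor_coeff_deriv_ident_mult:
  assumes "f analytic_on {0}"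
  shows "taylor_coeff (deriv (\<lambda>z. z * f z)) k = of_nat (Suc k) * taylor_coeff f k"
proof -
  have "f has_fps_expansion fps_expansion f 0"
    using analytic_at_imp_has_fps_expansion[OF assms] by simp
  then have "deriv (\<lambda>z. z * f z) has_fps_expansion fps_deriv (fps_X * fps_expansion f 0)"
    by (intro fps_expansion_intros)
  from fps_nth_fps_expansion[OF this, of k] show ?thesis
    by (simp add: taylor_coeff_def fps_expansion_def fps_deriv_nth del: fps_deriv_mult of_nat_Suc)
qed

lemma taylor_coeff_eq_contour_integral:
  assumes "continuous_on (cball 0 r) f" "f holomorphic_on ball 0 r" "0 < r"
  shows "taylor_coeff f k = contour_integral (circlepath 0 r) (\<lambda>u. f u / u ^ Suc k) / (2 * pi * \<i>)"
  unfolding taylor_coeff_def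
  using Cauchy_higher_derivative_integral_circlepath(2)[OF assms(1,2), of 0 k] assms(3) by simp

lemma circle_integral_eq_taylor_coeff:
  assumes holo: "continuous_on (cball 0 r) f" "f holomorphic_on ball 0 r" and radius: "0 < r"
  shows "integral {0..2*pi} (\<lambda>t. f (of_real r * cis t) * cnj (cis (real k * t))) =
    2 * pi * taylor_coeff f k * of_real r ^ k"
proof -
  have integrand: "f (0 + of_real r * cis t) / (0 + of_real r * cis t) ^ Suc k * of_real r * \<i> * cis t =
      \<i> / of_real r ^ k * (f (of_real r * cis t) * cnj (cis (real k * t)))" for t
    using radius by (simp add: power_mult_distrib Complex.DeMoivre divide_simps cis_cnj cis_mult)
  have "2 * pi * \<i> * taylor_coeff f k =
      \<i> / of_real r ^ k * integral {0..2*pi} (\<lambda>t. f (of_real r * cis t) * cnj (cis (real k * t)))"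
    unfolding taylor_coeff_eq_contour_integral[OF assms] circlepath_def
    by (subst contour_integral_part_circlepath_eq) (simp_all only: integrand, simp_all)
  then show ?thesis using radius by (simp add: field_simps)
qed

lemma circle_integral_cnj_eq_taylor_coeff:
  assumes "continuous_on (cball 0 r) f" "f holomorphic_on ball 0 r" "0 < r"
  shows "integral {0..2*pi} (\<lambda>t. cis (real k * t) * cnj (f (of_real r * cis t))) =
    2 * pi * cnj (taylor_coeff f k) * of_real r ^ k"
  using arg_cong[OF circle_integral_eq_taylor_coeff[OF assms], of cnj k]
  by (simp add: integral_cnj mult.commute)

lemma taylor_coeff_circle_sums:
  assumes holo: "f holomorphic_on ball 0 \<rho>" and radius: "0 \<le> r" "r < \<rho>"
  shows "summable (\<lambda>k. norm (taylor_coeff f k * of_real r ^ k))"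
    and "(\<lambda>k. taylor_coeff f k * of_real r ^ k * cis (real k * t)) sums f (of_real r * cis t)"
proof -
  have power_series: "(\<lambda>k. taylor_coeff f k * z ^ k) sums f z" if "norm z < \<rho>" for z
    using holomorphic_power_series[OF holo, of z] that by (simp add: taylor_coeff_def)
  obtain s where between: "r < s" "s < \<rho>" using radius dense by blast
  then have "summable (\<lambda>k. taylor_coeff f k * of_real s ^ k)"
    using power_series[of "of_real s"] radius by (simp add: sums_iff)
  from powser_insidea[OF this, of "of_real r"]
  show "summable (\<lambda>k. norm (taylor_coeff f k * of_real r ^ k))" using between radius by simp
  show "(\<lambda>k. taylor_coeff f k * of_real r ^ k * cis (real k * t)) sums f (of_real r * cis t)"
    using power_series[of "of_real r * cis t"] radius
    by (simp add: norm_mult power_mult_distrib Complex.DeMoivre mult.assoc)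
qed

lemma integral_sums_M_test:
  fixes h :: "nat \<Rightarrow> real \<Rightarrow> 'a::euclidean_space"
  assumes cont: "\<And>k. continuous_on {a..b} (h k)"
    and bound: "\<And>k t. t \<in> {a..b} \<Longrightarrow> norm (h k t) \<le> M k" and "summable M"
    and sums: "\<And>t. t \<in> {a..b} \<Longrightarrow> (\<lambda>k. h k t) sums F t"
  shows "(\<lambda>k. integral {a..b} (h k)) sums integral {a..b} F"
proof -
  have "uniform_limit {a..b} (\<lambda>n t. \<Sum>k<n. h k t) (\<lambda>t. \<Sum>k. h k t) sequentially"
    by (rule Weierstrass_m_test[OF bound \<open>summable M\<close>])
  then have "uniform_limit {a..b} (\<lambda>n t. \<Sum>k<n. h k t) F sequentially"
    by (rule uniform_limit_cong'[THEN iffD1, rotated -1]) (use sums in \<open>simp_all add: sums_iff\<close>)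
  then have "(\<lambda>n. integral {a..b} (\<lambda>t. \<Sum>k<n. h k t)) \<longlonglongrightarrow> integral {a..b} F"
    by (rule uniform_limit_integral) (auto simp: has_integral_iff intro!: continuous_intros cont)
  moreover have "integral {a..b} (\<lambda>t. \<Sum>k<n. h k t) = (\<Sum>k<n. integral {a..b} (h k))" for n
    by (intro integral_sum integrable_continuous_interval cont) simp
  ultimately show ?thesis by (simp add: sums_def)
qed

lemma continuous_on_circle:
  assumes "f holomorphic_on ball 0 \<rho>" "0 \<le> r" "r < \<rho>"
  shows "continuous_on A (\<lambda>t. f (of_real r * cis t))"
  by (rule continuous_on_compose2[OF holomorphic_on_imp_continuous_on[OF assms(1)]])
     (use assms(2,3) in \<open>auto simp: norm_mult intro!: continuous_intros\<close>)

theorem parseval_circle: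
  assumes holo_f: "f holomorphic_on ball 0 \<rho>" and holo_g: "g holomorphic_on ball 0 \<rho>"
    and radius: "0 < r" "r < \<rho>"
  shows "(\<lambda>k. 2 * pi * (taylor_coeff f k * cnj (taylor_coeff g k) * of_real r ^ (2 * k))) sums
    integral {0..2*pi} (\<lambda>t. f (of_real r * cis t) * cnj (g (of_real r * cis t)))"
proof -
  have cont_g: "continuous_on A (\<lambda>t. g (of_real r * cis t))" for A
    by (rule continuous_on_circle[OF holo_g]) (use radius in auto)
  have "bounded ((\<lambda>t. g (of_real r * cis t)) ` {0..2*pi})"
    by (intro compact_imp_bounded compact_continuous_image cont_g compact_Icc)
  then obtain G where bound_g: "\<And>t. t \<in> {0..2*pi} \<Longrightarrow> norm (g (of_real r * cis t)) \<le> G"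
    unfolding bounded_iff by blast
  define a where "a = (\<lambda>k. taylor_coeff f k * of_real r ^ k)"
  have "(\<lambda>k. integral {0..2*pi} (\<lambda>t. a k * cis (real k * t) * cnj (g (of_real r * cis t)))) sums
    integral {0..2*pi} (\<lambda>t. f (of_real r * cis t) * cnj (g (of_real r * cis t)))"
  proof (rule integral_sums_M_test)
    show "summable (\<lambda>k. norm (a k) * G)"
      unfolding a_def using taylor_coeff_circle_sums(1)[OF holo_f] radius
      by (intro summable_mult2) auto
    show "norm (a k * cis (real k * t) * cnj (g (of_real r * cis t))) \<le> norm (a k) * G"
      if "t \<in> {0..2*pi}" for k t
      using bound_g[OF that] by (simp add: norm_mult mult_left_mono)
    show "(\<lambda>k. a k * cis (real k * t) * cnj (g (of_real r * cis t))) sums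
        (f (of_real r * cis t) * cnj (g (of_real r * cis t)))" for t
      unfolding a_def
      by (rule sums_mult2, rule taylor_coeff_circle_sums(2)[OF holo_f]) (use radius in auto)
  qed (intro continuous_intros cont_g)
  moreover have "integral {0..2*pi} (\<lambda>t. a k * cis (real k * t) * cnj (g (of_real r * cis t))) =
      2 * pi * (taylor_coeff f k * cnj (taylor_coeff g k) * of_real r ^ (2 * k))" for k
  proof -
    have "integral {0..2*pi} (\<lambda>t. cis (real k * t) * cnj (g (of_real r * cis t))) =
        2 * pi * cnj (taylor_coeff g k) * of_real r ^ k"
      by (rule circle_integral_cnj_eq_taylor_coeff)
         (use radius in \<open>auto intro!: holomorphic_on_imp_continuous_on holomorphic_on_subset[OF holo_g]\<close>)
    moreover have "integral {0..2*pi} (\<lambda>t. a k * cis (real k * t) * cnj (g (of_real r * cis t))) =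
        a k * integral {0..2*pi} (\<lambda>t. cis (real k * t) * cnj (g (of_real r * cis t)))"
      by (simp add: mult.assoc)
    ultimately show ?thesis by (simp add: a_def mult_2[of k] power_add)
  qed
  ultimately show ?thesis by (simp only:)
qed

corollary parseval_circle_norm:
  assumes holo: "f holomorphic_on ball 0 \<rho>" and radius: "0 < r" "r < \<rho>"
  shows "(\<lambda>k. 2 * pi * ((norm (taylor_coeff f k))\<^sup>2 * r ^ (2 * k))) sums
    integral {0..2*pi} (\<lambda>t. (norm (f (of_real r * cis t)))\<^sup>2)"
proof -
  have "((\<lambda>t. (norm (f (of_real r * cis t)))\<^sup>2) has_integral
      integral {0..2*pi} (\<lambda>t. (norm (f (of_real r * cis t)))\<^sup>2)) {0..2*pi}"
    by (intro integrable_integral integrable_continuous_interval continuous_intros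
          continuous_on_circle[OF holo])
       (use radius in auto)
  then have "integral {0..2*pi} (\<lambda>t. complex_of_real ((norm (f (of_real r * cis t)))\<^sup>2)) =
      of_real (integral {0..2*pi} (\<lambda>t. (norm (f (of_real r * cis t)))\<^sup>2))"
    by (intro integral_unique has_integral_of_real)
  then have "(\<lambda>k. complex_of_real (2 * pi * ((norm (taylor_coeff f k))\<^sup>2 * r ^ (2 * k)))) sums
      of_real (integral {0..2*pi} (\<lambda>t. (norm (f (of_real r * cis t)))\<^sup>2))"
    using parseval_circle[OF holo holo radius] unfolding complex_norm_square[symmetric] by simp
  then show ?thesis unfolding sums_of_real_iff .
qed

text \<open>Parseval's identity for \<open>(z f)'\<close> and \<open>f\<close>.\<close>
lemma weighted_taylor_coeff_sum_le:
  assumes holo: "f holomorphic_on ball 0 \<rho>" and radius: "0 < r" "r < \<rho>"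
    and bound: "\<And>t. norm (f (of_real r * cis t)) \<le> M"
  shows "(\<Sum>k. ennreal ((real k + 1) * (norm (taylor_coeff f k))\<^sup>2 * r ^ (2 * k))) \<le>
    ennreal (M * integral {0..2*pi} (\<lambda>t. norm (deriv (\<lambda>z. z * f z) (of_real r * cis t))) / (2 * pi))"
proof -
  define D where "D = deriv (\<lambda>z. z * f z)"
  define w where "w = (\<lambda>k. (real k + 1) * (norm (taylor_coeff f k))\<^sup>2 * r ^ (2 * k))"
  define J where "J = integral {0..2*pi} (\<lambda>t. D (of_real r * cis t) * cnj (f (of_real r * cis t)))"
  have holo_D: "D holomorphic_on ball 0 \<rho>"
    unfolding D_def by (intro holomorphic_deriv holomorphic_intros holo) simp
  have "f analytic_on {0}"
    by (rule holomorphic_on_imp_analytic_at[OF holo]) (use radius in auto)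
  then have "taylor_coeff D k * cnj (taylor_coeff f k) =
      of_real ((real k + 1) * (norm (taylor_coeff f k))\<^sup>2)" for k
    unfolding D_def of_real_mult complex_norm_square by (simp add: taylor_coeff_deriv_ident_mult)
  then have "2 * pi * (taylor_coeff D k * cnj (taylor_coeff f k) * of_real r ^ (2 * k)) =
      of_real (2 * pi * w k)" for k
    by (simp add: w_def)
  then have "(\<lambda>k. complex_of_real (2 * pi * w k)) sums J"
    using parseval_circle[OF holo_D holo radius] unfolding J_def by (simp only:)
  from sums_divide[OF sums_Re[OF this], of "2 * pi"] have w_sums: "w sums (Re J / (2 * pi))" by simp
  have "norm J \<le> integral {0..2*pi} (\<lambda>t. M * norm (D (of_real r * cis t)))"
    unfolding J_def
    by (intro integral_norm_bound_integral integrable_continuous_interval continuous_intros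
          continuous_on_circle[OF holo] continuous_on_circle[OF holo_D])
       (use radius bound in \<open>auto simp: norm_mult mult.commute[of M] intro!: mult_left_mono\<close>)
  then have Re_J_le: "Re J \<le> M * integral {0..2*pi} (\<lambda>t. norm (D (of_real r * cis t)))"
    using complex_Re_le_cmod[of J] by simp
  have "(\<Sum>k. ennreal (w k)) = ennreal (Re J / (2 * pi))"
    unfolding sums_unique[OF w_sums]
    by (rule suminf_ennreal2[OF _ sums_summable[OF w_sums]]) (use radius in \<open>simp add: w_def\<close>)
  also have "\<dots> \<le> ennreal (M * integral {0..2*pi} (\<lambda>t. norm (D (of_real r * cis t))) / (2 * pi))"
    using Re_J_le by (intro ennreal_leI divide_right_mono) auto
  finally show ?thesis by (simp add: w_def D_def)
qed

subsection \<open>Taylor coefficients in two variables\<close>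

lemma continuous_on_contour_integral_param:
  assumes path: "valid_path g" "continuous_on {0..1} (\<lambda>t. vector_derivative g (at t))"
    and cont: "continuous_on (S \<times> path_image g) (\<lambda>(x, z). F x z)"
  shows "continuous_on S (\<lambda>x. contour_integral g (F x))"
proof -
  have "continuous_on (S \<times> cbox 0 1) (\<lambda>x. F (fst x) (g (snd x)))"
    using continuous_on_compose2[OF cont, of "S \<times> cbox 0 1" "\<lambda>x. (fst x, g (snd x))"]
    by (force simp: path_image_def intro!: continuous_intros
          continuous_on_compose2[OF valid_path_imp_path[OF path(1), unfolded path_def]])
  moreover have "continuous_on (S \<times> cbox 0 1) (\<lambda>x. vector_derivative g (at (snd x)))"
    by (rule continuous_on_compose2[OF path(2)]) (auto intro!: continuous_intros)
  ultimately have "continuous_on S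
      (\<lambda>x. integral (cbox 0 1) (\<lambda>t. F x (g t) * vector_derivative g (at t)))"
    unfolding case_prod_unfold
    by (intro integral_continuous_on_param) (auto simp: case_prod_unfold intro!: continuous_intros)
  then show ?thesis by (simp add: contour_integral_integral)
qed

lemma contour_integral_triangle_eq_0:
  assumes holo: "f holomorphic_on convex hull {a, b, c}"
  shows "contour_integral (linepath a b) f + contour_integral (linepath b c) f +
    contour_integral (linepath c a) f = 0"
proof -
  have "f contour_integrable_on linepath u v" if "u \<in> {a, b, c}" "v \<in> {a, b, c}" for u v
  proof -
    have "closed_segment u v \<subseteq> convex hull {a, b, c}"
      unfolding segment_convex_hull using that by (intro hull_mono) auto
    then show ?thesis
      by (intro contour_integrable_continuous_linepath holomorphic_on_imp_continuous_on)
         (rule holomorphic_on_subset[OF holo])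
  qed
  then show ?thesis
    using contour_integral_unique[OF Cauchy_theorem_triangle[OF holo]] by (simp add: add.assoc)
qed

lemma holomorphic_on_circlepath_integral:
  assumes open_W: "open W" and cont: "continuous_on (sphere 0 r \<times> W) (\<lambda>(z, w). F z w)"
    and radius: "0 < r"
    and holo: "\<And>z. z \<in> sphere 0 r \<Longrightarrow> F z holomorphic_on W"
  shows "(\<lambda>w. contour_integral (circlepath 0 r) (\<lambda>z. F z w)) holomorphic_on W"
proof -
  let ?C = "circlepath 0 r"
  define G where "G = (\<lambda>w. contour_integral ?C (\<lambda>z. F z w))"
  have image: "path_image ?C = sphere 0 r" using radius by simp
  have smooth: "valid_path ?C" "continuous_on {0..1} (\<lambda>t. vector_derivative ?C (at t))"
    by (auto simp: vector_derivative_circlepath intro!: continuous_intros)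
  have "G analytic_on W"
  proof (intro Morera_triangle[OF _ open_W] allI impI)
    show "continuous_on W G"
      unfolding G_def using continuous_on_swap_args[OF cont]
      by (intro continuous_on_contour_integral_param smooth) (unfold image)
    fix a b c assume triangle: "convex hull {a, b, c} \<subseteq> W"
    let ?side = "\<lambda>a b z. contour_integral (linepath a b) (F z)"
    have segments: "closed_segment a b \<subseteq> W" "closed_segment b c \<subseteq> W" "closed_segment c a \<subseteq> W"
      unfolding segment_convex_hull by (rule order_trans[OF hull_mono triangle]; blast)+
    have cont_segment: "continuous_on (sphere 0 r \<times> closed_segment u v) (\<lambda>(z, w). F z w)"
      if "closed_segment u v \<subseteq> W" for u v
      by (rule continuous_on_subset[OF cont]) (use that in auto)
    have swap: "contour_integral (linepath u v) G = contour_integral ?C (?side u v)"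
      if "closed_segment u v \<subseteq> W" for u v
      unfolding G_def
      by (rule contour_integral_swap[symmetric]) (use smooth cont_segment[OF that] image in auto)
    have side: "?side u v contour_integrable_on ?C" if "closed_segment u v \<subseteq> W" for u v
      using continuous_on_contour_integral_param[of "linepath u v" "sphere 0 r" F]
        cont_segment[OF that] radius
      by (intro contour_integrable_continuous_circlepath) auto
    have "?side a b z + ?side b c z + ?side c a z = 0" if "z \<in> sphere 0 r" for z
      by (rule contour_integral_triangle_eq_0[OF holomorphic_on_subset[OF holo[OF that] triangle]])
    then have "contour_integral ?C (\<lambda>z. ?side a b z + ?side b c z + ?side c a z) =
        contour_integral ?C (\<lambda>_. 0)"
      by (intro contour_integral_eq) (simp only: image)
    then show "contour_integral (linepath a b) G + contour_integral (linepath b c) G +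
        contour_integral (linepath c a) G = 0"
      using segments by (simp add: swap contour_integral_add side contour_integrable_add)
  qed
  then show ?thesis unfolding G_def by (rule analytic_imp_holomorphic)
qed

lemma holomorphic_on_taylor_coeff_param:
  assumes open_W: "open W" and radius: "0 < r"
    and cont: "continuous_on (cball 0 r \<times> W) (\<lambda>(z, w). f z w)"
    and holo_fst: "\<And>w. w \<in> W \<Longrightarrow> (\<lambda>z. f z w) holomorphic_on ball 0 r"
    and holo_snd: "\<And>z. z \<in> cball 0 r \<Longrightarrow> f z holomorphic_on W"
  shows "(\<lambda>w. taylor_coeff (\<lambda>z. f z w) k) holomorphic_on W"
proof -
  have "(\<lambda>w. contour_integral (circlepath 0 r) (\<lambda>z. f z w / z ^ Suc k)) holomorphic_on W"
  proof (rule holomorphic_on_circlepath_integral[OF open_W _ radius])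
    have "continuous_on (sphere 0 r \<times> W) (\<lambda>(z, w). f z w)"
      by (rule continuous_on_subset[OF cont]) auto
    then show "continuous_on (sphere 0 r \<times> W) (\<lambda>(z, w). f z w / z ^ Suc k)"
      unfolding case_prod_unfold by (intro continuous_intros) (use radius in auto)
    show "(\<lambda>w. f z w / z ^ Suc k) holomorphic_on W" if "z \<in> sphere 0 r" for z
      by (intro holomorphic_intros holo_snd) (use that radius in auto)
  qed
  then have "(\<lambda>w. contour_integral (circlepath 0 r) (\<lambda>z. f z w / z ^ Suc k) / (2 * pi * \<i>))
      holomorphic_on W"
    by (intro holomorphic_intros) auto
  moreover have "taylor_coeff (\<lambda>z. f z w) k =
      contour_integral (circlepath 0 r) (\<lambda>z. f z w / z ^ Suc k) / (2 * pi * \<i>)" if "w \<in> W" for w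
  proof (rule taylor_coeff_eq_contour_integral[OF _ holo_fst[OF that] radius])
    show "continuous_on (cball 0 r) (\<lambda>z. f z w)"
      using continuous_on_compose2[OF cont, of "cball 0 r" "\<lambda>z. (z, w)"] that
      by (force intro!: continuous_intros)
  qed
  ultimately show ?thesis by (simp cong: holomorphic_cong)
qed

lemma holo_bidisc_swap: "holo_bidisc f \<Longrightarrow> holo_bidisc (\<lambda>z w. f w z)"
  using continuous_on_swap_args[of "ball 0 1" "ball 0 1" f] by (simp add: holo_bidisc_def)

lemma holo_bidisc_taylor_coeff_holomorphic:
  assumes "holo_bidisc f"
  shows "(\<lambda>w. taylor_coeff (\<lambda>z. f z w) k) holomorphic_on ball 0 1"
proof (rule holomorphic_on_taylor_coeff_param[where r = "1/2"])
  show "continuous_on (cball 0 (1/2) \<times> ball 0 1) (\<lambda>(z, w). f z w)"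
    by (rule continuous_on_subset[of "ball 0 1 \<times> ball 0 1"])
       (use assms in \<open>auto simp: holo_bidisc_def\<close>)
  show "(\<lambda>z. f z w) holomorphic_on ball 0 (1/2)" if "w \<in> ball 0 1" for w
    by (rule holomorphic_on_subset[of _ "ball 0 1"]) (use assms that in \<open>auto simp: holo_bidisc_def\<close>)
qed (use assms in \<open>auto simp: holo_bidisc_def\<close>)

lemma holo_bidisc_iterated_taylor_coeff:
  assumes holo: "holo_bidisc f"
  shows "taylor_coeff (\<lambda>w. taylor_coeff (\<lambda>z. f z w) k) l =
    contour_integral (circlepath 0 (1/2)) (\<lambda>w. contour_integral (circlepath 0 (1/2))
      (\<lambda>z. f z w / (z ^ Suc k * w ^ Suc l))) / (2 * pi * \<i>)\<^sup>2"
proof -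
  let ?C = "circlepath (0::complex) (1/2)"
  have contour: "taylor_coeff g k = contour_integral ?C (\<lambda>z. g z / z ^ Suc k) / (2 * pi * \<i>)"
    if "g holomorphic_on ball 0 1" for g k
    by (intro taylor_coeff_eq_contour_integral holomorphic_on_imp_continuous_on
          holomorphic_on_subset[OF that]) auto
  have slice: "(\<lambda>z. f z w) holomorphic_on ball 0 1" if "w \<in> ball 0 1" for w
    using holo that by (simp add: holo_bidisc_def)
  have divide: "contour_integral \<gamma> (\<lambda>z. g z / c) = contour_integral \<gamma> g / c" for \<gamma> g c
    by (simp add: contour_integral_integral flip: integral_divide)
  have "taylor_coeff (\<lambda>w. taylor_coeff (\<lambda>z. f z w) k) l =
      contour_integral ?C (\<lambda>w. taylor_coeff (\<lambda>z. f z w) k / w ^ Suc l) / (2 * pi * \<i>)"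
    by (rule contour[OF holo_bidisc_taylor_coeff_holomorphic[OF holo]])
  also have "\<dots> = contour_integral ?C (\<lambda>w. contour_integral ?C
        (\<lambda>z. f z w / (z ^ Suc k * w ^ Suc l)) / (2 * pi * \<i>)) / (2 * pi * \<i>)"
  proof (rule arg_cong2[where f = divide, OF contour_integral_eq refl])
    fix w assume "w \<in> path_image ?C"
    then have w_in_ball: "w \<in> ball 0 1" by simp
    have "contour_integral ?C (\<lambda>z. f z w / (z ^ Suc k * w ^ Suc l)) =
        contour_integral ?C (\<lambda>z. f z w / z ^ Suc k) / w ^ Suc l"
      using divide[of _ "\<lambda>z. f z w / z ^ Suc k" "w ^ Suc l"] by (simp only: divide_divide_eq_left)
    then show "taylor_coeff (\<lambda>z. f z w) k / w ^ Suc l =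
        contour_integral ?C (\<lambda>z. f z w / (z ^ Suc k * w ^ Suc l)) / (2 * pi * \<i>)"
      by (simp only: contour[OF slice[OF w_in_ball]] divide_divide_eq_left mult.commute)
  qed
  finally show ?thesis by (simp add: divide power2_eq_square)
qed

lemma taylor2_eq_iterated_taylor_coeff:
  assumes "holo_bidisc f"
  shows "taylor2 f k l = taylor_coeff (\<lambda>z. taylor_coeff (f z) l) k"
proof -
  have "(deriv ^^ l) (f z) 0 = fact l * taylor_coeff (f z) l" for z
    by (simp add: taylor_coeff_def)
  then have "taylor2 f k l = taylor_coeff (\<lambda>z. fact l * taylor_coeff (f z) l) k / fact l"
    by (simp add: taylor2_def taylor_coeff_def)
  moreover have "(\<lambda>z. taylor_coeff (f z) l) analytic_on {0}"
    using holo_bidisc_taylor_coeff_holomorphic[OF holo_bidisc_swap[OF assms]]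
    by (rule holomorphic_on_imp_analytic_at) auto
  ultimately show ?thesis by (simp add: taylor_coeff_cmult)
qed

lemma taylor2_swap:
  assumes holo: "holo_bidisc f"
  shows "taylor2 (\<lambda>z w. f w z) k l = taylor2 f l k"
proof -
  let ?C = "circlepath (0::complex) (1/2)"
  have "contour_integral ?C (\<lambda>w. contour_integral ?C (\<lambda>z. f z w / (z ^ Suc l * w ^ Suc k))) =
      contour_integral ?C (\<lambda>z. contour_integral ?C (\<lambda>w. f z w / (z ^ Suc l * w ^ Suc k)))"
  proof (rule contour_integral_swap[symmetric])
    have "continuous_on (sphere 0 (1/2) \<times> sphere 0 (1/2)) (\<lambda>(z, w). f z w)"
      by (rule continuous_on_subset[of "ball 0 1 \<times> ball 0 1"])
         (use holo in \<open>auto simp: holo_bidisc_def\<close>)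
    then show "continuous_on (path_image ?C \<times> path_image ?C) (\<lambda>(z, w). f z w / (z ^ Suc l * w ^ Suc k))"
      unfolding case_prod_unfold by (auto intro!: continuous_intros)
  qed (auto simp: vector_derivative_circlepath intro!: continuous_intros)
  then have "taylor_coeff (\<lambda>w. taylor_coeff (\<lambda>z. f z w) l) k = taylor_coeff (\<lambda>z. taylor_coeff (f z) k) l"
    using holo_bidisc_iterated_taylor_coeff[OF holo, of l k]
      holo_bidisc_iterated_taylor_coeff[OF holo_bidisc_swap[OF holo], of k l] by (simp only: mult.commute)
  then show ?thesis
    by (simp add: taylor2_eq_iterated_taylor_coeff holo holo_bidisc_swap)
qed

subsection \<open>Arc length\<close>

definition angle_measure :: "real measure" where
  "angle_measure = restrict_space lborel {0..2*pi}"

lemma space_angle_measure [simp]: "space angle_measure = {0..2*pi}"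
  by (simp add: angle_measure_def space_restrict_space)

lemma emeasure_angle_measure: "emeasure angle_measure {0..2*pi} = ennreal (2 * pi)"
  by (simp add: angle_measure_def emeasure_restrict_space)

interpretation angle: finite_measure angle_measure
  by (rule finite_measureI) (simp add: emeasure_angle_measure)

abbreviation torus_measure :: "(real \<times> real) measure" where
  "torus_measure \<equiv> angle_measure \<Otimes>\<^sub>M angle_measure"

interpretation torus: pair_sigma_finite angle_measure angle_measure ..

lemma nn_integral_angle_measure: "(\<integral>\<^sup>+t. f t \<partial>angle_measure) = (\<integral>\<^sup>+t\<in>{0..2*pi}. f t \<partial>lborel)"
  unfolding angle_measure_def by (rule nn_integral_restrict_space) simp

lemma AE_angle_measure_iff: "(AE t in angle_measure. Q t) \<longleftrightarrow> (AE t in lborel. t \<in> {0..2*pi} \<longrightarrow> Q t)"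
  unfolding angle_measure_def by (rule AE_restrict_space_iff) simp

lemma borel_measurable_angle_measure [measurable]:
  "f \<in> borel_measurable borel \<Longrightarrow> f \<in> borel_measurable angle_measure"
  unfolding angle_measure_def by (intro measurable_restrict_space1) simp

lemma nn_integral_angle_measure_continuous:
  assumes "continuous_on {0..2*pi} f" "\<And>t. t \<in> {0..2*pi} \<Longrightarrow> 0 \<le> f t"
  shows "(\<integral>\<^sup>+t. ennreal (f t) \<partial>angle_measure) = ennreal (integral {0..2*pi} f)"
  unfolding nn_integral_angle_measure
  by (rule nn_integral_has_integral_lebesgue')
     (use assms in \<open>auto intro!: integrable_integral integrable_continuous_interval\<close>)

definition circle_norm_powr :: "real \<Rightarrow> (complex \<Rightarrow> complex) \<Rightarrow> ennreal" where
  "circle_norm_powr P f = (\<integral>\<^sup>+s. ennreal (norm (f (cis s)) powr P) \<partial>angle_measure)"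

corollary parseval_unit_circle:
  assumes holo: "f holomorphic_on ball 0 \<rho>" and rho: "1 < \<rho>"
  shows "(\<integral>\<^sup>+t. ennreal ((norm (f (cis t)))\<^sup>2) \<partial>angle_measure) =
    (\<Sum>k. ennreal (2 * pi * (norm (taylor_coeff f k))\<^sup>2))"
proof -
  have sums: "(\<lambda>k. 2 * pi * (norm (taylor_coeff f k))\<^sup>2) sums
      integral {0..2*pi} (\<lambda>t. (norm (f (cis t)))\<^sup>2)"
    using parseval_circle_norm[OF holo, of 1] rho by simp
  have "continuous_on A (\<lambda>t. f (cis t))" for A
    using continuous_on_circle[OF holo, of 1] rho by simp
  then have "(\<integral>\<^sup>+t. ennreal ((norm (f (cis t)))\<^sup>2) \<partial>angle_measure) =
      ennreal (integral {0..2*pi} (\<lambda>t. (norm (f (cis t)))\<^sup>2))"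
    by (intro nn_integral_angle_measure_continuous continuous_intros) auto
  also have "\<dots> = (\<Sum>k. ennreal (2 * pi * (norm (taylor_coeff f k))\<^sup>2))"
    unfolding sums_unique[OF sums]
    by (rule suminf_ennreal2[OF _ sums_summable[OF sums], symmetric]) simp
  finally show ?thesis .
qed

lemma inj_on_cis: "inj_on cis {0..<2*pi}"
proof (rule inj_on_inverseI)
  fix s assume "s \<in> {0..<2*pi}"
  then show "Arg2pi (cis s) = s" by (intro Arg2pi_unique[of 1]) (auto simp: cis_conv_exp)
qed

lemma AE_cis_poly_nonzero:
  assumes "p \<noteq> 0"
  shows "AE s in angle_measure. poly p (cis s) \<noteq> 0"
proof -
  have "finite (insert (2*pi) (cis -` {z. poly p z = 0} \<inter> {0..<2*pi}))"
    using finite_vimage_IntI[OF poly_roots_finite[OF assms] inj_on_cis] by simp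
  from AE_not_in[OF finite_imp_null_set_lborel[OF this]] show ?thesis
    unfolding AE_angle_measure_iff by eventually_elim auto
qed

subsection \<open>Finite Blaschke products\<close>

definition blaschke_factor :: "complex \<Rightarrow> complex \<Rightarrow> complex" where
  "blaschke_factor a z = (z - a) / (1 - cnj a * z)"

definition blaschke :: "complex list \<Rightarrow> complex \<Rightarrow> complex" where
  "blaschke as z = (\<Prod>a\<leftarrow>as. blaschke_factor a z)"

definition poisson_kernel :: "complex \<Rightarrow> complex \<Rightarrow> real" where
  "poisson_kernel a z = (1 - (norm a)\<^sup>2) / (norm (1 - cnj a * z))\<^sup>2"

lemma blaschke_simps [simp]:
  "blaschke [] z = 1" "blaschke (a # as) z = blaschke_factor a z * blaschke as z"
  by (simp_all add: blaschke_def)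

lemma blaschke_append: "blaschke (as @ bs) z = blaschke as z * blaschke bs z"
  by (simp add: blaschke_def)

lemma poisson_kernel_nonneg: "norm a \<le> 1 \<Longrightarrow> 0 \<le> poisson_kernel a z"
  by (simp add: poisson_kernel_def power_le_one)

lemma one_minus_cnj_mult_nonzero:
  assumes "norm a * norm z < 1"
  shows "1 - cnj a * z \<noteq> 0"
proof
  assume "1 - cnj a * z = 0"
  then have "norm (cnj a * z) = 1" by simp
  then show False using assms by (simp add: norm_mult)
qed

lemma norm_blaschke_factor_sq:
  assumes "1 - cnj a * z \<noteq> 0"
  shows "(norm (blaschke_factor a z))\<^sup>2 = 1 - (1 - (norm z)\<^sup>2) * poisson_kernel a z"
proof -
  have "complex_of_real ((norm (z - a))\<^sup>2) =
      of_real ((norm (1 - cnj a * z))\<^sup>2 - (1 - (norm z)\<^sup>2) * (1 - (norm a)\<^sup>2))"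
    unfolding of_real_diff of_real_mult complex_norm_square by (simp add: algebra_simps)
  then have "(norm (z - a))\<^sup>2 = (norm (1 - cnj a * z))\<^sup>2 - (1 - (norm z)\<^sup>2) * (1 - (norm a)\<^sup>2)"
    by (simp only: of_real_eq_iff)
  then show ?thesis
    unfolding blaschke_factor_def poisson_kernel_def norm_divide power_divide
    using assms by (simp add: diff_divide_distrib flip: times_divide_eq_right)
qed

lemma blaschke_factor_has_derivative:
  assumes "1 - cnj a * z \<noteq> 0"
  shows "(blaschke_factor a has_field_derivative of_real (1 - (norm a)\<^sup>2) / (1 - cnj a * z)\<^sup>2) (at z)"
proof -
  have "(blaschke_factor a has_field_derivative
     ((1 - cnj a * z) - (z - a) * (- cnj a)) / ((1 - cnj a * z) * (1 - cnj a * z))) (at z)"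
    unfolding blaschke_factor_def [abs_def]
    using assms by (auto intro!: derivative_eq_intros)
  moreover have "(1 - cnj a * z) - (z - a) * (- cnj a) = of_real (1 - (norm a)\<^sup>2)"
    unfolding of_real_diff complex_norm_square by (simp add: algebra_simps)
  ultimately show ?thesis unfolding power2_eq_square[of "1 - cnj a * z"] by (simp only:)
qed

lemma blaschke_factor_field_differentiable:
  "1 - cnj a * z \<noteq> 0 \<Longrightarrow> blaschke_factor a field_differentiable at z"
  using blaschke_factor_has_derivative unfolding field_differentiable_def by blast

lemma norm_deriv_blaschke_factor:
  assumes "norm a \<le> 1" "1 - cnj a * z \<noteq> 0"
  shows "norm (deriv (blaschke_factor a) z) = poisson_kernel a z"
  unfolding DERIV_imp_deriv[OF blaschke_factor_has_derivative[OF assms(2)]] poisson_kernel_def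
  using assms(1) by (simp add: norm_divide norm_power power_le_one del: of_real_diff)

lemma blaschke_field_differentiable:
  assumes "\<And>a. a \<in> set as \<Longrightarrow> 1 - cnj a * z \<noteq> 0"
  shows "blaschke as field_differentiable at z"
  using assms
proof (induction as)
  case (Cons a as)
  have "(\<lambda>z. blaschke_factor a z * blaschke as z) field_differentiable at z"
    by (intro field_differentiable_mult blaschke_factor_field_differentiable Cons.IH)
       (use Cons.prems in auto)
  then show ?case by (simp add: blaschke_def [abs_def])
qed (simp add: blaschke_def [abs_def])

lemma holomorphic_on_blaschke:
  assumes "\<And>a z. a \<in> set as \<Longrightarrow> z \<in> S \<Longrightarrow> 1 - cnj a * z \<noteq> 0"
  shows "blaschke as holomorphic_on S"
  unfolding holomorphic_on_def
  using blaschke_field_differentiable assms by (blast intro: field_differentiable_at_within)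

lemma holomorphic_on_blaschke_ball:
  assumes zeros: "\<And>a. a \<in> set as \<Longrightarrow> norm a \<le> 1 - \<epsilon>" and eps: "0 < \<epsilon>"
  shows "blaschke as holomorphic_on ball 0 (1 + \<epsilon>)"
proof (intro holomorphic_on_blaschke one_minus_cnj_mult_nonzero)
  fix a z :: complex assume zero_mem: "a \<in> set as" and z_in_ball: "z \<in> ball 0 (1 + \<epsilon>)"
  have "\<epsilon> \<le> 1" using zeros[OF zero_mem] norm_ge_zero[of a] by linarith
  then have "norm a * norm z \<le> (1 - \<epsilon>) * (1 + \<epsilon>)"
    using zeros[OF zero_mem] z_in_ball by (intro mult_mono) auto
  also have "\<dots> < 1" using eps by (simp add: algebra_simps)
  finally show "norm a * norm z < 1" .
qed

lemma deriv_blaschke_Cons: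
  assumes "\<And>b. b \<in> set (a # as) \<Longrightarrow> 1 - cnj b * z \<noteq> 0"
  shows "deriv (blaschke (a # as)) z =
    blaschke_factor a z * deriv (blaschke as) z + deriv (blaschke_factor a) z * blaschke as z"
proof -
  have "blaschke_factor a field_differentiable at z" "blaschke as field_differentiable at z"
    by (intro blaschke_factor_field_differentiable blaschke_field_differentiable; use assms in auto)+
  then show ?thesis by (subst deriv_mult[symmetric]) (simp_all add: blaschke_def [abs_def])
qed

lemma one_minus_norm_half_le:
  fixes a z :: complex
  assumes "norm a \<le> 1 - \<epsilon>" "norm z \<le> 1 + \<epsilon>/2" "0 < \<epsilon>"
  shows "(1 - norm a) / 2 \<le> 1 - norm a * norm z"
proof -
  have "norm a * norm z \<le> norm a * (1 + \<epsilon>/2)" using assms by (intro mult_left_mono) auto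
  moreover have "norm a * (\<epsilon>/2) \<le> 1 * (\<epsilon>/2)" using assms by (intro mult_right_mono) auto
  ultimately show ?thesis using assms unfolding distrib_left by argo
qed

lemma zeros_off_annulus_nonzero:
  assumes "norm a \<le> 1 - \<epsilon>" "norm z \<le> 1 + \<epsilon>/2" "0 < \<epsilon>"
  shows "1 - cnj a * z \<noteq> 0"
  using one_minus_norm_half_le[OF assms] assms by (intro one_minus_cnj_mult_nonzero) argo

lemma norm_blaschke_factor_le:
  assumes zero: "norm a \<le> 1 - \<epsilon>" and point: "norm z \<le> 1 + \<epsilon>/2" and eps: "0 < \<epsilon>"
  shows "norm (blaschke_factor a z) \<le> 4"
proof -
  define r where "r = 1 - norm a"
  have r_bounds: "0 < r" "r \<le> 1" "\<epsilon> \<le> r" using zero eps by (auto simp: r_def)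
  have "r / 2 \<le> norm (1 - cnj a * z)"
    using one_minus_norm_half_le[OF assms] norm_triangle_ineq2[of 1 "cnj a * z"]
    by (simp add: r_def norm_mult)
  then have "(r / 2)\<^sup>2 \<le> (norm (1 - cnj a * z))\<^sup>2" using r_bounds by (intro power_mono) auto
  moreover have "1 - (norm a)\<^sup>2 \<le> 2 * r"
    using zero_le_power2[of r] by (simp add: r_def power2_eq_square algebra_simps)
  ultimately have "poisson_kernel a z \<le> 2 * r / (r / 2)\<^sup>2"
    unfolding poisson_kernel_def using r_bounds by (intro frac_le) auto
  also have "\<dots> = 8 / r" using r_bounds by (simp add: power2_eq_square)
  finally have kernel: "poisson_kernel a z \<le> 8 / r" .
  have "(norm z)\<^sup>2 \<le> (1 + \<epsilon>/2)\<^sup>2" using point by (intro power_mono) auto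
  also have "\<dots> \<le> 1 + 5/4 * r"
  proof -
    have "\<epsilon> * \<epsilon> \<le> r * 1" using r_bounds eps by (intro mult_mono) auto
    then show ?thesis using r_bounds by (simp add: power2_eq_square algebra_simps)
  qed
  finally have "((norm z)\<^sup>2 - 1) * poisson_kernel a z \<le> (5/4 * r) * (8 / r)"
    using kernel r_bounds zero eps by (intro mult_mono poisson_kernel_nonneg) auto
  then have "(norm (blaschke_factor a z))\<^sup>2 \<le> 11"
    unfolding norm_blaschke_factor_sq[OF zeros_off_annulus_nonzero[OF assms]]
    using r_bounds by (simp add: algebra_simps)
  then have "(norm (blaschke_factor a z))\<^sup>2 \<le> 4\<^sup>2" by simp
  then show ?thesis by (rule power2_le_imp_le) simp
qed

lemma norm_blaschke_le:
  assumes "\<And>a. a \<in> set as \<Longrightarrow> norm a \<le> 1 - \<epsilon>" "norm z \<le> 1 + \<epsilon>/2" "0 < \<epsilon>"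
  shows "norm (blaschke as z) \<le> 4 ^ length as"
  using assms(1)
proof (induction as)
  case (Cons a as)
  show ?case using norm_blaschke_factor_le[OF _ assms(2,3), of a] Cons
    by (auto simp: norm_mult intro!: mult_mono)
qed simp

lemma norm_deriv_blaschke_le:
  assumes "\<And>a. a \<in> set as \<Longrightarrow> norm a \<le> 1 - \<epsilon>" and point: "norm z \<le> 1 + \<epsilon>/2" "0 < \<epsilon>"
  shows "norm (deriv (blaschke as) z) \<le> 4 ^ length as * (\<Sum>a\<leftarrow>as. poisson_kernel a z)"
  using assms(1)
proof (induction as)
  case Nil
  then show ?case by (simp add: blaschke_def [abs_def])
next
  case (Cons a as)
  have zero: "norm a \<le> 1 - \<epsilon>" by (simp add: Cons.prems)
  have kernel: "norm (deriv (blaschke_factor a) z) = poisson_kernel a z"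
    by (rule norm_deriv_blaschke_factor)
       (use zero point zeros_off_annulus_nonzero[OF zero point] in auto)
  then have kernel_nonneg: "0 \<le> poisson_kernel a z" by (metis norm_ge_zero)
  have "norm (deriv (blaschke (a # as)) z) \<le>
      norm (blaschke_factor a z) * norm (deriv (blaschke as) z) +
      poisson_kernel a z * norm (blaschke as z)"
    using zeros_off_annulus_nonzero[OF Cons.prems point]
    by (subst deriv_blaschke_Cons) (auto simp: kernel norm_mult intro: norm_triangle_mono)
  also have "\<dots> \<le> 4 * (4 ^ length as * (\<Sum>a\<leftarrow>as. poisson_kernel a z)) + poisson_kernel a z * 4 ^ length as"
    using Cons kernel_nonneg norm_blaschke_factor_le[OF zero point] norm_blaschke_le[OF _ point, of as]
    by (intro add_mono mult_mono) auto
  also have "\<dots> \<le> 4 ^ length (a # as) * (\<Sum>a\<leftarrow>a # as. poisson_kernel a z)"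
    using kernel_nonneg by (simp add: algebra_simps)
  finally show ?case .
qed

lemma circle_integral_poisson_kernel:
  assumes "norm a < 1"
  shows "((\<lambda>t. poisson_kernel a (cis t)) has_integral 2 * pi) {0..2*pi}"
proof -
  define F where "F = (\<lambda>z. (1 + cnj a * z) / (1 - cnj a * z))"
  have nonzero: "1 - cnj a * z \<noteq> 0" if "norm z \<le> 1" for z
    by (rule one_minus_cnj_mult_nonzero) (use mult_left_mono[OF that, of "norm a"] assms in auto)
  have Re_mult: "Re ((1 + w) * cnj (1 - w)) = 1 - (norm w)\<^sup>2" for w
    unfolding cmod_power2 by (simp add: power2_eq_square algebra_simps)
  have "poisson_kernel a (cis t) = Re (F (cis t))" for t
  proof -
    have "Re (F (cis t)) =
        Re ((1 + cnj a * cis t) * cnj (1 - cnj a * cis t)) / (norm (1 - cnj a * cis t))\<^sup>2"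
      unfolding F_def by (subst complex_div_cnj) (simp only: Re_divide_of_real flip: of_real_power)
    also have "Re ((1 + cnj a * cis t) * cnj (1 - cnj a * cis t)) = 1 - (norm a)\<^sup>2"
      unfolding Re_mult by (simp add: norm_mult)
    finally show ?thesis by (simp add: poisson_kernel_def)
  qed
  moreover have "((\<lambda>t. Re (F (cis t))) has_integral Re (2 * pi)) {0..2*pi}"
  proof (rule has_integral_Re)
    have cont: "continuous_on (cball 0 1) F" "F holomorphic_on ball 0 1"
      unfolding F_def using nonzero by (auto intro!: continuous_intros holomorphic_intros)
    have "(\<lambda>t. F (cis t)) integrable_on {0..2*pi}"
      by (intro integrable_continuous_interval continuous_on_compose2[OF cont(1)] continuous_intros)
         auto
    moreover have "integral {0..2*pi} (\<lambda>t. F (cis t)) = 2 * pi"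
      using circle_integral_eq_taylor_coeff[OF cont, of 0] by (simp add: taylor_coeff_def F_def)
    ultimately show "((\<lambda>t. F (cis t)) has_integral 2 * pi) {0..2*pi}" by (simp add: has_integral_iff)
  qed
  ultimately show ?thesis by simp
qed

lemma poisson_kernel_dilation_le:
  assumes zero: "norm a \<le> 1 - \<epsilon>" and radius: "0 \<le> r" "r \<le> 1 + \<epsilon>/2" and eps: "0 < \<epsilon>"
  shows "poisson_kernel a (of_real r * z) \<le> 4 * poisson_kernel (of_real r * a) z"
proof -
  have half: "(1 - norm a) / 2 \<le> 1 - norm (of_real r * a)"
    using one_minus_norm_half_le[OF zero _ eps, of "of_real r"] radius
    by (simp add: norm_mult mult.commute)
  have "1 - (norm a)\<^sup>2 \<le> 2 * (1 - norm a)"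
    using zero_le_power2[of "1 - norm a"] by (simp add: power2_eq_square algebra_simps)
  also have "\<dots> \<le> 4 * (1 - norm (of_real r * a))" using half by simp
  also have "\<dots> \<le> 4 * (1 - (norm (of_real r * a))\<^sup>2)"
    using half zero eps by (simp add: power2_eq_square mult_left_le_one_le del: norm_mult)
  finally have "(1 - (norm a)\<^sup>2) / (norm (1 - cnj a * (of_real r * z)))\<^sup>2 \<le>
      4 * (1 - (norm (of_real r * a))\<^sup>2) / (norm (1 - cnj a * (of_real r * z)))\<^sup>2"
    by (rule divide_right_mono) simp
  then show ?thesis by (simp add: poisson_kernel_def mult_ac)
qed

lemma has_integral_sum_list:
  fixes f :: "'b \<Rightarrow> 'n::euclidean_space \<Rightarrow> 'c::real_normed_vector"
  assumes "\<And>a. a \<in> set as \<Longrightarrow> (f a has_integral I a) S"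
  shows "((\<lambda>x. \<Sum>a\<leftarrow>as. f a x) has_integral (\<Sum>a\<leftarrow>as. I a)) S"
  using assms by (induction as) (auto intro: has_integral_add)

lemma integral_norm_deriv_blaschke_le:
  assumes zeros: "\<And>a. a \<in> set as \<Longrightarrow> norm a \<le> 1 - \<epsilon>" and eps: "0 < \<epsilon>"
    and radius: "0 < r" "r \<le> 1 + \<epsilon>/2"
  shows "integral {0..2*pi} (\<lambda>t. norm (deriv (blaschke as) (of_real r * cis t))) \<le>
    8 * pi * real (length as) * 4 ^ length as"
proof -
  have "((\<lambda>t. 4 ^ length as * (\<Sum>a\<leftarrow>as. 4 * poisson_kernel (of_real r * a) (cis t))) has_integral
      4 ^ length as * (\<Sum>a\<leftarrow>as. 4 * (2 * pi))) {0..2*pi}"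
  proof (intro has_integral_mult_right has_integral_sum_list circle_integral_poisson_kernel)
    show "norm (of_real r * a) < 1" if "a \<in> set as" for a
      using one_minus_norm_half_le[OF zeros[OF that] _ eps, of "of_real r"] zeros[OF that] eps radius
      by (simp add: norm_mult mult.commute)
  qed
  then have "((\<lambda>t. 4 ^ length as * (\<Sum>a\<leftarrow>as. 4 * poisson_kernel (of_real r * a) (cis t))) has_integral
      8 * pi * real (length as) * 4 ^ length as) {0..2*pi}"
    by (simp add: sum_list_triv mult_ac)
  then show ?thesis
  proof (rule has_integral_le[OF integrable_integral, rotated])
    show "(\<lambda>t. norm (deriv (blaschke as) (of_real r * cis t))) integrable_on {0..2*pi}"
      by (intro integrable_continuous_interval continuous_intros continuous_on_circle[where \<rho> = "1 + \<epsilon>"]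
          holomorphic_deriv holomorphic_on_blaschke_ball zeros) (use radius eps in auto)
    fix t :: real
    have "norm (deriv (blaschke as) (of_real r * cis t)) \<le>
        4 ^ length as * (\<Sum>a\<leftarrow>as. poisson_kernel a (of_real r * cis t))"
      by (rule norm_deriv_blaschke_le[OF zeros _ eps]) (use radius in \<open>auto simp: norm_mult\<close>)
    also have "\<dots> \<le> 4 ^ length as * (\<Sum>a\<leftarrow>as. 4 * poisson_kernel (of_real r * a) (cis t))"
      using radius
      by (intro mult_left_mono sum_list_mono poisson_kernel_dilation_le[OF zeros _ _ eps]) auto
    finally show "norm (deriv (blaschke as) (of_real r * cis t)) \<le>
        4 ^ length as * (\<Sum>a\<leftarrow>as. 4 * poisson_kernel (of_real r * a) (cis t))" .
  qed
qed

lemma powr_le_geometric_growth: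
  assumes q_nonneg: "0 \<le> q" and eps: "0 < \<epsilon>" "\<epsilon> \<le> 1"
  shows "(real k + 1) powr q \<le> 2 * (4 * (q + 1)) powr q * \<epsilon> powr (-q) * (1 + \<epsilon>/2) ^ (2 * k)"
proof -
  define b where "b = 4 * (q + 1)"
  define x where "x = (real k + 1) * \<epsilon>"
  have b_pos: "0 < b" and x_pos: "0 < x" using q_nonneg eps by (auto simp: b_def x_def)
  have "x / b \<le> exp (x / b)" by (rule order_trans[OF _ exp_ge_add_one_self]) simp
  then have "(x / b) powr q \<le> exp (x / b) powr q"
    using q_nonneg b_pos x_pos by (intro powr_mono2) auto
  then have "x powr q \<le> b powr q * exp (q * x / b)"
    using b_pos x_pos by (simp add: powr_divide exp_powr_real pos_divide_le_eq mult.commute)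
  also have "exp (q * x / b) \<le> exp (x / 4)"
    using q_nonneg x_pos by (simp add: b_def divide_simps)
  also have "exp (x / 4) \<le> 2 * (1 + \<epsilon>/2) ^ (2 * k)"
  proof -
    have exp_small: "exp (t / 4) \<le> 1 + t / 2" if "0 \<le> t" "t \<le> 1" for t :: real
    proof -
      have "t\<^sup>2 \<le> t" using that by (simp add: power2_eq_square mult_left_le)
      then show ?thesis using exp_bound[of "t / 4"] that by (simp add: power_divide)
    qed
    have "x / 4 = \<epsilon> / 4 + real k * (\<epsilon> / 4)" by (simp add: x_def distrib_right add_divide_distrib)
    then have "exp (x / 4) = exp (\<epsilon> / 4) * exp (\<epsilon> / 4) ^ k" by (simp only: exp_add exp_of_nat_mult)
    also have "\<dots> \<le> (1 + 1/2) * (1 + \<epsilon>/2) ^ k"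
      using exp_small[of \<epsilon>] eps by (intro mult_mono power_mono) auto
    also have "\<dots> \<le> 2 * (1 + \<epsilon>/2) ^ (2 * k)"
      using eps by (intro mult_mono power_increasing) auto
    finally show ?thesis .
  qed
  finally have "x powr q \<le> b powr q * (2 * (1 + \<epsilon>/2) ^ (2 * k))" by (simp add: mult_left_mono)
  then have "\<epsilon> powr (-q) * x powr q \<le> \<epsilon> powr (-q) * (b powr q * (2 * (1 + \<epsilon>/2) ^ (2 * k)))"
    by (rule mult_left_mono) simp
  moreover have "\<epsilon> powr (-q) * x powr q = (real k + 1) powr q"
    using eps by (simp add: x_def powr_mult powr_minus)
  ultimately show ?thesis by (simp add: b_def mult_ac)
qed

lemma blaschke_weighted_sum_le:
  assumes zeros: "\<And>a. a \<in> set as \<Longrightarrow> norm a \<le> 1 - \<epsilon>" and eps: "0 < \<epsilon>" "\<epsilon> \<le> 1"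
  shows "(\<Sum>k. ennreal ((real k + 1) * (norm (taylor_coeff (blaschke as) k))\<^sup>2 * (1 + \<epsilon>/2) ^ (2 * k))) \<le>
    ennreal ((real (length as) + 1) * 16 ^ Suc (length as))"
proof -
  define n where "n = length as"
  have on_circle: "norm (of_real (1 + \<epsilon>/2) * cis t) \<le> 1 + \<epsilon>/2" for t
    using eps by (simp add: norm_mult del: of_real_add)
  have ident_mult: "(\<lambda>z. z * blaschke as z) = blaschke (0 # as)"
    by (simp add: fun_eq_iff blaschke_factor_def)
  have zeros_Cons: "norm a \<le> 1 - \<epsilon>" if "a \<in> set (0 # as)" for a using that zeros eps by auto
  have "(\<Sum>k. ennreal ((real k + 1) * (norm (taylor_coeff (blaschke as) k))\<^sup>2 * (1 + \<epsilon>/2) ^ (2 * k))) \<le>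
      ennreal (4 ^ n * integral {0..2*pi}
        (\<lambda>t. norm (deriv (blaschke (0 # as)) (of_real (1 + \<epsilon>/2) * cis t))) / (2 * pi))"
    unfolding n_def ident_mult[symmetric]
    by (intro weighted_taylor_coeff_sum_le[OF holomorphic_on_blaschke_ball] norm_blaschke_le)
       (use zeros eps on_circle in auto)
  also have "\<dots> \<le> ennreal (4 ^ n * (8 * pi * real (Suc n) * 4 ^ Suc n) / (2 * pi))"
    using integral_norm_deriv_blaschke_le[of "0 # as" \<epsilon> "1 + \<epsilon>/2"] zeros_Cons eps
    by (intro ennreal_leI divide_right_mono mult_left_mono) (simp_all add: n_def)
  also have "4 ^ n * (8 * pi * real (Suc n) * 4 ^ Suc n) / (2 * pi) = (real n + 1) * 16 ^ Suc n"
    using power_mult_distrib[of "4::real" 4 n] by simp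
  finally show ?thesis by (simp add: n_def)
qed

definition dirichlet_norm_sq :: "real \<Rightarrow> (complex \<Rightarrow> complex) \<Rightarrow> ennreal" where
  "dirichlet_norm_sq P f = (\<Sum>k. ennreal ((real k + 1) powr P * (norm (taylor_coeff f k))\<^sup>2))"

lemma blaschke_dirichlet_norm_sq_le:
  fixes P :: real
  assumes zeros: "\<And>a. a \<in> set as \<Longrightarrow> norm a \<le> 1 - \<epsilon>" and eps: "0 < \<epsilon>" "\<epsilon> \<le> 1"
    and q_bounds: "0 \<le> q" "P \<le> q + 1"
  shows "dirichlet_norm_sq P (blaschke as) \<le>
    ennreal (2 * (4 * (q + 1)) powr q * \<epsilon> powr (-q) * ((real (length as) + 1) * 16 ^ Suc (length as)))"
proof -
  define b where "b = (\<lambda>k. (norm (taylor_coeff (blaschke as) k))\<^sup>2)"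
  define c where "c = 2 * (4 * (q + 1)) powr q * \<epsilon> powr (-q)"
  have c_nonneg: "0 \<le> c" by (simp add: c_def)
  have "(real k + 1) powr P * b k \<le> c * ((real k + 1) * b k * (1 + \<epsilon>/2) ^ (2 * k))" for k
  proof -
    have "(real k + 1) powr P \<le> (real k + 1) powr (1 + q)" using q_bounds by (intro powr_mono) auto
    also have "\<dots> = (real k + 1) * (real k + 1) powr q" by (simp add: powr_add)
    also have "\<dots> \<le> (real k + 1) * (c * (1 + \<epsilon>/2) ^ (2 * k))"
      unfolding c_def using powr_le_geometric_growth[OF q_bounds(1) eps]
      by (intro mult_left_mono) auto
    finally have "(real k + 1) powr P * b k \<le> (real k + 1) * (c * (1 + \<epsilon>/2) ^ (2 * k)) * b k"
      by (rule mult_right_mono) (simp add: b_def)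
    then show ?thesis by (simp only: mult_ac)
  qed
  then have "dirichlet_norm_sq P (blaschke as) \<le>
      (\<Sum>k. ennreal c * ennreal ((real k + 1) * b k * (1 + \<epsilon>/2) ^ (2 * k)))"
    unfolding dirichlet_norm_sq_def ennreal_mult'[OF c_nonneg, symmetric]
    by (intro suminf_le ennreal_leI) (auto simp: b_def)
  also have "\<dots> \<le> ennreal c * ennreal ((real (length as) + 1) * 16 ^ Suc (length as))"
    unfolding ennreal_suminf_cmult b_def
    using blaschke_weighted_sum_le[OF zeros eps] by (intro mult_left_mono) auto
  finally show ?thesis using c_nonneg by (simp only: ennreal_mult'[symmetric] c_def)
qed

lemma deriv_blaschke_circle:
  assumes "\<And>a. a \<in> set as \<Longrightarrow> norm a < 1" and circle: "norm z = 1"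
  shows "z * deriv (blaschke as) z = blaschke as z * of_real (\<Sum>a\<leftarrow>as. poisson_kernel a z)"
  using assms(1)
proof (induction as)
  case Nil
  then show ?case by (simp add: blaschke_def [abs_def])
next
  case (Cons a as)
  define D where "D = 1 - cnj a * z"
  have nonzero: "1 - cnj b * z \<noteq> 0" if "b \<in> set (a # as)" for b
    by (rule one_minus_cnj_mult_nonzero) (use Cons.prems[OF that] circle in simp)
  then have D_nonzero: "D \<noteq> 0" by (simp add: D_def)
  have "z * cnj z = 1" using circle by (simp flip: complex_norm_square)
  then have "z - a = z * cnj D" by (simp add: D_def algebra_simps)
  moreover have "of_real (poisson_kernel a z) = of_real (1 - (norm a)\<^sup>2) / (D * cnj D)"
    unfolding poisson_kernel_def of_real_divide D_def complex_norm_square[of "1 - cnj a * z"] ..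
  moreover have "deriv (blaschke_factor a) z = of_real (1 - (norm a)\<^sup>2) / D\<^sup>2"
    unfolding D_def
    by (rule DERIV_imp_deriv[OF blaschke_factor_has_derivative]) (use D_nonzero in \<open>simp add: D_def\<close>)
  ultimately have factor:
    "z * deriv (blaschke_factor a) z = blaschke_factor a z * of_real (poisson_kernel a z)"
    using D_nonzero by (simp add: blaschke_factor_def power2_eq_square flip: D_def)
  have "z * deriv (blaschke (a # as)) z =
      blaschke_factor a z * (z * deriv (blaschke as) z) +
      (z * deriv (blaschke_factor a) z) * blaschke as z"
    by (subst deriv_blaschke_Cons) (use nonzero in \<open>auto simp: algebra_simps\<close>)
  also have "\<dots> = blaschke (a # as) z * of_real (\<Sum>a\<leftarrow>a # as. poisson_kernel a z)"
    unfolding factor using Cons by (simp add: algebra_simps)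
  finally show ?case .
qed

lemma norm_blaschke_circle:
  assumes "\<And>a. a \<in> set as \<Longrightarrow> norm a < 1" and circle: "norm z = 1"
  shows "norm (blaschke as z) = 1"
  using assms(1)
proof (induction as)
  case (Cons a as)
  have "1 - cnj a * z \<noteq> 0" by (rule one_minus_cnj_mult_nonzero) (use Cons.prems circle in simp)
  from norm_blaschke_factor_sq[OF this] have "norm (blaschke_factor a z) = 1"
    using circle by (simp add: power2_eq_1_iff) (metis norm_ge_zero not_one_le_zero neg_0_le_iff_le)
  then show ?case using Cons by (simp add: norm_mult)
qed simp

lemma poisson_kernel_le_norm_deriv_blaschke:
  assumes zeros: "\<And>a. a \<in> set as \<Longrightarrow> norm a < 1" and circle: "norm z = 1" and zero_mem: "a \<in> set as"
  shows "poisson_kernel a z \<le> norm (deriv (blaschke as) z)"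
proof -
  have "norm (deriv (blaschke as) z) = \<bar>\<Sum>a\<leftarrow>as. poisson_kernel a z\<bar>"
    using arg_cong[where f = norm, OF deriv_blaschke_circle[OF zeros circle]]
      norm_blaschke_circle[OF zeros circle] circle
    by (simp only: norm_mult norm_of_real mult_1)
  moreover have "poisson_kernel a z \<le> (\<Sum>a\<leftarrow>as. poisson_kernel a z)"
    by (rule member_le_sum_list)
       (use zero_mem zeros in \<open>auto intro: poisson_kernel_nonneg less_imp_le\<close>)
  ultimately show ?thesis by simp
qed

lemma poisson_kernel_cis_ge:
  assumes zero: "norm a < 1" and near: "\<bar>s - Arg2pi a\<bar> \<le> 1 - norm a"
  shows "1 / (4 * (1 - norm a)) \<le> poisson_kernel a (cis s)"
proof -
  define \<epsilon> where "\<epsilon> = 1 - norm a"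
  have eps: "0 < \<epsilon>" "\<epsilon> \<le> 1" using zero by (auto simp: \<epsilon>_def)
  have "norm (1 - cis x) \<le> \<bar>x\<bar>" for x
    using abs_sin_x_le_abs_x[of "x / 2"] dist_exp_i_1[of x]
    by (simp add: cis_conv_exp norm_minus_commute)
  then have "norm (1 - cis (s - Arg2pi a)) \<le> \<epsilon>" using near order_trans unfolding \<epsilon>_def by blast
  then have arc: "norm a * norm (1 - cis (s - Arg2pi a)) \<le> 1 * \<epsilon>"
    using zero by (intro mult_mono) auto
  have "cnj a = cnj (of_real (norm a) * cis (Arg2pi a))"
    unfolding cis_conv_exp using Arg2pi_eq[of a] by (simp only: mult.commute)
  then have "cnj a * cis s = of_real (norm a) * cis (s - Arg2pi a)"
    by (simp add: cis_cnj cis_mult)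
  then have "1 - cnj a * cis s = of_real \<epsilon> + of_real (norm a) * (1 - cis (s - Arg2pi a))"
    by (simp add: \<epsilon>_def algebra_simps)
  also have "norm \<dots> \<le> \<epsilon> + norm a * norm (1 - cis (s - Arg2pi a))"
    using eps by (intro norm_triangle_le add_mono) (auto simp: norm_mult)
  finally have upper: "norm (1 - cnj a * cis s) \<le> 2 * \<epsilon>" using arc by simp
  have pos: "0 < norm (1 - cnj a * cis s)"
    using one_minus_cnj_mult_nonzero[of a "cis s"] zero by simp
  have "1 / (4 * \<epsilon>) = \<epsilon> / (2 * \<epsilon>)\<^sup>2" using eps by (simp add: power2_eq_square)
  also have "\<dots> \<le> poisson_kernel a (cis s)"
    unfolding poisson_kernel_def
  proof (rule frac_le)
    show "\<epsilon> \<le> 1 - (norm a)\<^sup>2" using zero by (simp add: \<epsilon>_def power2_eq_square mult_left_le_one_le)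
    show "0 \<le> 1 - (norm a)\<^sup>2" using zero by (simp add: power_le_one)
    show "(norm (1 - cnj a * cis s))\<^sup>2 \<le> (2 * \<epsilon>)\<^sup>2" using upper pos by (intro power_mono) auto
  qed (use pos in simp)
  finally show ?thesis by (simp add: \<epsilon>_def)
qed

lemma circle_norm_powr_deriv_blaschke_ge:
  assumes zeros: "\<And>b. b \<in> set as \<Longrightarrow> norm b < 1" and zero_mem: "a \<in> set as" and P_nonneg: "0 \<le> P"
  shows "ennreal ((1 - norm a) powr (1 - P)) \<le>
    ennreal (4 powr P) * circle_norm_powr P (deriv (blaschke as))"
proof -
  define \<epsilon> where "\<epsilon> = 1 - norm a"
  define h where "h = (1 / (4 * \<epsilon>)) powr P"
  have eps: "0 < \<epsilon>" "\<epsilon> \<le> 1" using zeros[OF zero_mem] by (auto simp: \<epsilon>_def)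
  define u where "u = (if Arg2pi a \<le> pi then Arg2pi a else Arg2pi a - \<epsilon>)"
  have arc: "{u..u+\<epsilon>} \<subseteq> {0..2*pi}" "\<And>s. s \<in> {u..u+\<epsilon>} \<Longrightarrow> \<bar>s - Arg2pi a\<bar> \<le> \<epsilon>"
    using eps Arg2pi[of a] pi_gt3 by (auto simp: u_def split: if_splits)
  have "{u..u+\<epsilon>} \<in> sets angle_measure" "emeasure angle_measure {u..u+\<epsilon>} = ennreal \<epsilon>"
    using arc(1) eps
    by (simp_all add: angle_measure_def sets_restrict_space_iff emeasure_restrict_space)
  then have "ennreal h * ennreal \<epsilon> = (\<integral>\<^sup>+s. ennreal h * indicator {u..u+\<epsilon>} s \<partial>angle_measure)"
    by (simp add: nn_integral_cmult_indicator)
  also have "\<dots> \<le> circle_norm_powr P (deriv (blaschke as))"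
    unfolding circle_norm_powr_def
  proof (rule nn_integral_mono)
    fix s
    have "h \<le> norm (deriv (blaschke as) (cis s)) powr P" if s_in_arc: "s \<in> {u..u+\<epsilon>}"
      unfolding h_def
    proof (rule powr_mono2[OF P_nonneg])
      have "1 / (4 * \<epsilon>) \<le> poisson_kernel a (cis s)"
        using poisson_kernel_cis_ge[OF zeros[OF zero_mem]] arc(2)[OF s_in_arc] by (simp add: \<epsilon>_def)
      also have "\<dots> \<le> norm (deriv (blaschke as) (cis s))"
        by (rule poisson_kernel_le_norm_deriv_blaschke[OF zeros _ zero_mem]) auto
      finally show "1 / (4 * \<epsilon>) \<le> norm (deriv (blaschke as) (cis s))" .
    qed (use eps in simp)
    then show "ennreal h * indicator {u..u+\<epsilon>} s \<le> ennreal (norm (deriv (blaschke as) (cis s)) powr P)"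
      by (auto simp: indicator_def intro: ennreal_leI)
  qed
  finally have "ennreal (4 powr P) * (ennreal h * ennreal \<epsilon>) \<le>
      ennreal (4 powr P) * circle_norm_powr P (deriv (blaschke as))"
    by (rule mult_left_mono) simp
  moreover have "4 powr P * (h * \<epsilon>) = \<epsilon> powr (1 - P)"
    using eps by (simp add: h_def powr_divide powr_mult powr_diff)
  moreover have "0 \<le> h" by (simp add: h_def)
  ultimately show ?thesis using eps by (simp add: \<epsilon>_def flip: ennreal_mult)
qed

lemma circle_norm_powr_deriv_blaschke_ge_max:
  assumes zeros: "\<And>b. b \<in> set as \<Longrightarrow> norm b < 1" and P_nonneg: "0 \<le> P"
    and eps_mem: "\<epsilon> \<in> insert 1 ((\<lambda>a. 1 - norm a) ` set as)"
  shows "ennreal (\<epsilon> powr (- max 0 (P - 1))) \<le>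
    ennreal (4 powr P) * (1 + circle_norm_powr P (deriv (blaschke as)))"
proof -
  have eps_pos: "0 < \<epsilon>" using eps_mem zeros by auto
  have one_le: "1 * 1 \<le> ennreal (4 powr P) * (1 + circle_norm_powr P (deriv (blaschke as)))"
    using P_nonneg by (intro mult_mono) (auto simp: ge_one_powr_ge_zero)
  consider "\<epsilon> = 1" | "P \<le> 1" | a where "a \<in> set as" "\<epsilon> = 1 - norm a" "1 < P"
    using eps_mem by fastforce
  then show ?thesis
  proof cases
    case (3 a)
    then have "ennreal (\<epsilon> powr (- max 0 (P - 1))) \<le>
        ennreal (4 powr P) * circle_norm_powr P (deriv (blaschke as))"
      using circle_norm_powr_deriv_blaschke_ge[of as a P] zeros P_nonneg by simp
    also have "\<dots> \<le> ennreal (4 powr P) * (1 + circle_norm_powr P (deriv (blaschke as)))"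
      by (intro mult_left_mono) auto
    finally show ?thesis .
  qed (use eps_pos one_le in auto)
qed

definition blaschke_dirichlet_const :: "real \<Rightarrow> nat \<Rightarrow> real" where
  "blaschke_dirichlet_const P m =
     2 * (4 * (max 0 (P - 1) + 1)) powr max 0 (P - 1) * ((real m + 1) * 16 ^ Suc m) * 4 powr P"

proposition blaschke_dirichlet_norm_sq_le_circle_norm:
  assumes P_nonneg: "0 \<le> P" and zeros_in_disc: "\<And>a. a \<in> set as \<Longrightarrow> norm a < 1"
    and length_le: "length as \<le> m"
  shows "dirichlet_norm_sq P (blaschke as) \<le>
    ennreal (blaschke_dirichlet_const P m) * (1 + circle_norm_powr P (deriv (blaschke as)))"
proof -
  define q where "q = max 0 (P - 1)"
  define K where "K = 2 * (4 * (q + 1)) powr q * ((real m + 1) * 16 ^ Suc m)"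
  have q_bounds: "0 \<le> q" "P \<le> q + 1" and K_nonneg: "0 \<le> K" by (auto simp: q_def K_def)
  define \<epsilon> where "\<epsilon> = Min (insert 1 ((\<lambda>a. 1 - norm a) ` set as))"
  have eps_mem: "\<epsilon> \<in> insert 1 ((\<lambda>a. 1 - norm a) ` set as)" unfolding \<epsilon>_def by (rule Min_in) auto
  have eps: "0 < \<epsilon>" "\<epsilon> \<le> 1" using zeros_in_disc by (auto simp: \<epsilon>_def)
  have "\<epsilon> \<le> 1 - norm a" if "a \<in> set as" for a unfolding \<epsilon>_def using that by (intro Min_le) auto
  then have zeros: "norm a \<le> 1 - \<epsilon>" if "a \<in> set as" for a using that by fastforce
  have degree: "(real (length as) + 1) * 16 ^ Suc (length as) \<le> (real m + 1) * 16 ^ Suc m"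
    using length_le by (intro mult_mono power_increasing) auto
  have "dirichlet_norm_sq P (blaschke as) \<le>
      ennreal (2 * (4 * (q + 1)) powr q * \<epsilon> powr (-q) * ((real (length as) + 1) * 16 ^ Suc (length as)))"
    by (rule blaschke_dirichlet_norm_sq_le[OF zeros eps q_bounds])
  also have "\<dots> \<le> ennreal (2 * (4 * (q + 1)) powr q * \<epsilon> powr (-q) * ((real m + 1) * 16 ^ Suc m))"
    using degree by (intro ennreal_leI mult_left_mono) auto
  also have "\<dots> = ennreal (K * \<epsilon> powr (-q))" by (simp only: K_def mult_ac)
  also have "\<dots> = ennreal K * ennreal (\<epsilon> powr (-q))" using K_nonneg by (simp add: ennreal_mult')
  also have "\<dots> \<le> ennreal K * (ennreal (4 powr P) * (1 + circle_norm_powr P (deriv (blaschke as))))"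
    unfolding q_def
    by (intro mult_left_mono circle_norm_powr_deriv_blaschke_ge_max[OF zeros_in_disc P_nonneg eps_mem])
       simp_all
  also have "\<dots> = ennreal (blaschke_dirichlet_const P m) * (1 + circle_norm_powr P (deriv (blaschke as)))"
    using K_nonneg by (simp add: blaschke_dirichlet_const_def K_def q_def ennreal_mult' mult.assoc)
  finally show ?thesis .
qed

subsection \<open>Reflections of polynomials\<close>

definition reflection :: "nat \<Rightarrow> complex poly \<Rightarrow> complex poly" where
  "reflection m p = (\<Sum>j\<le>m. monom (cnj (coeff p (m - j))) j)"

lemma coeff_reflection: "coeff (reflection m p) j = (if j \<le> m then cnj (coeff p (m - j)) else 0)"
  by (simp add: reflection_def coeff_sum coeff_monom sum.delta')

lemma reflection_Suc:
  assumes "degree p \<le> m"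
  shows "reflection (Suc m) p = [:0, 1:] * reflection m p"
proof (rule poly_eqI)
  fix j
  show "coeff (reflection (Suc m) p) j = coeff ([:0, 1:] * reflection m p) j"
    using assms by (cases j) (auto simp: coeff_reflection coeff_pCons coeff_eq_0)
qed

lemma reflection_linear_mult:
  assumes "degree p \<le> m"
  shows "reflection (Suc m) ([:-b, 1:] * p) = [:1, -cnj b:] * reflection m p"
proof (rule poly_eqI)
  fix j
  consider "j = 0" | i where "j = Suc i" "i < m" "m - i = Suc (m - Suc i)" | "j = Suc m" | "Suc m < j"
    by (cases j) force+
  then show "coeff (reflection (Suc m) ([:-b, 1:] * p)) j = coeff ([:1, -cnj b:] * reflection m p) j"
    using assms by cases (auto simp: coeff_reflection coeff_eq_0 coeff_pCons split: nat.split)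
qed

definition is_blaschke_quotient :: "nat \<Rightarrow> complex poly \<Rightarrow> complex poly \<Rightarrow> bool" where
  "is_blaschke_quotient m g p \<longleftrightarrow> (\<exists>u as. norm u = 1 \<and> length as \<le> m \<and> (\<forall>a\<in>set as. norm a < 1) \<and>
     (\<forall>z. poly p z \<noteq> 0 \<longrightarrow> (\<forall>a\<in>set as. 1 - cnj a * z \<noteq> 0) \<and> poly g z = u * blaschke as z * poly p z))"

lemma is_blaschke_quotient_const: "c \<noteq> 0 \<Longrightarrow> is_blaschke_quotient 0 [:cnj c:] [:c:]"
  unfolding is_blaschke_quotient_def
  by (intro exI[of _ "cnj c / c"] exI[of _ "[]"]) (simp add: norm_divide)

lemma is_blaschke_quotient_ident: "is_blaschke_quotient 1 [:0, 1:] 1"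
  unfolding is_blaschke_quotient_def
  by (intro exI[of _ 1] exI[of _ "[0]"]) (simp add: blaschke_factor_def)

lemma is_blaschke_quotient_linear:
  assumes "1 \<le> norm b"
  shows "is_blaschke_quotient 1 [:1, -cnj b:] [:-b, 1:]"
proof (cases "norm b = 1")
  case True
  then have "cnj b * b = 1" by (simp add: mult.commute flip: complex_norm_square)
  then show ?thesis
    unfolding is_blaschke_quotient_def using True
    by (intro exI[of _ "-cnj b"] exI[of _ "[]"]) (simp add: algebra_simps)
next
  case False
  then have b_outside: "1 < norm b" "b \<noteq> 0" using assms by auto
  define a where "a = 1 / cnj b"
  have denominator: "1 - cnj a * z = (b - z) / b" for z
    using b_outside by (simp add: a_def diff_divide_distrib)
  then have "1 - cnj b * z = cnj b / b * blaschke [a] z * (z - b)" if "z \<noteq> b" for z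
    unfolding blaschke_simps blaschke_factor_def denominator
    using that b_outside by (simp add: a_def divide_simps) (simp add: algebra_simps)
  then show ?thesis
    unfolding is_blaschke_quotient_def using b_outside denominator
    by (intro exI[of _ "cnj b / b"] exI[of _ "[a]"]) (auto simp: a_def norm_divide mult.commute)
qed

lemma is_blaschke_quotient_mult:
  assumes "is_blaschke_quotient m g p" "is_blaschke_quotient n h q"
  shows "is_blaschke_quotient (m + n) (g * h) (p * q)"
proof -
  obtain u as where quotient_g: "norm u = 1" "length as \<le> m" "\<forall>a\<in>set as. norm a < 1"
    "\<forall>z. poly p z \<noteq> 0 \<longrightarrow> (\<forall>a\<in>set as. 1 - cnj a * z \<noteq> 0) \<and> poly g z = u * blaschke as z * poly p z"
    using assms(1) unfolding is_blaschke_quotient_def by blast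
  obtain v bs where quotient_h: "norm v = 1" "length bs \<le> n" "\<forall>a\<in>set bs. norm a < 1"
    "\<forall>z. poly q z \<noteq> 0 \<longrightarrow> (\<forall>a\<in>set bs. 1 - cnj a * z \<noteq> 0) \<and> poly h z = v * blaschke bs z * poly q z"
    using assms(2) unfolding is_blaschke_quotient_def by blast
  show ?thesis
    unfolding is_blaschke_quotient_def using quotient_g quotient_h
    by (intro exI[of _ "u * v"] exI[of _ "as @ bs"]) (auto simp: norm_mult blaschke_append)
qed

theorem is_blaschke_quotient_reflection:
  assumes "degree p \<le> m" "\<And>z. norm z < 1 \<Longrightarrow> poly p z \<noteq> 0"
  shows "is_blaschke_quotient m (reflection m p) p"
  using assms
proof (induction m arbitrary: p)
  case 0
  then obtain c where p_const: "p = [:c:]" by (metis degree_eq_zeroE le_zero_eq)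
  moreover have "c \<noteq> 0" using "0.prems"(2)[of 0] p_const by simp
  ultimately show ?case using is_blaschke_quotient_const by (simp add: reflection_def monom_0)
next
  case (Suc m)
  show ?case
  proof (cases "degree p \<le> m")
    case True
    from is_blaschke_quotient_mult[OF is_blaschke_quotient_ident Suc.IH[OF True Suc.prems(2)]]
    show ?thesis by (simp add: reflection_Suc[OF True])
  next
    case False
    then have degree: "degree p = Suc m" using Suc.prems(1) by simp
    then obtain b where root: "poly p b = 0" using alg_closed_imp_poly_has_root[of p] by auto
    then obtain q where factor: "p = [:-b, 1:] * q" unfolding poly_eq_0_iff_dvd by (elim dvdE)
    have "q \<noteq> 0" using factor degree by auto
    then have degree_q: "degree q \<le> m"
      using degree unfolding factor by (subst (asm) degree_mult_eq) auto
    have "is_blaschke_quotient m (reflection m q) q"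
      by (rule Suc.IH[OF degree_q]) (use Suc.prems(2) in \<open>auto simp: factor\<close>)
    moreover have "1 \<le> norm b" using root Suc.prems(2)[of b] by (meson not_less)
    ultimately show ?thesis
      using is_blaschke_quotient_mult[OF is_blaschke_quotient_linear]
        reflection_linear_mult[OF degree_q] factor by simp
  qed
qed

lemma norm_deriv_unimodular_mult:
  assumes "\<forall>\<^sub>F y in nhds z. f y = u * g y" "norm u = 1" "g field_differentiable at z"
  shows "norm (deriv f z) = norm (deriv g z)"
  using deriv_cong_ev[OF assms(1) refl] assms(2,3) by (simp add: deriv_cmult norm_mult)

lemma dirichlet_norm_sq_unimodular_mult:
  assumes "\<forall>\<^sub>F z in nhds 0. f z = u * g z" "norm u = 1" "g analytic_on {0}"
  shows "dirichlet_norm_sq P f = dirichlet_norm_sq P g"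
  using assms(2,3)
  by (simp add: dirichlet_norm_sq_def taylor_coeff_cong[OF assms(1)] taylor_coeff_cmult norm_mult)

proposition reflection_dirichlet_norm_sq_le_circle_norm:
  assumes P_nonneg: "0 \<le> P" and degree: "degree p \<le> m" and nonzero: "\<And>z. norm z < 1 \<Longrightarrow> poly p z \<noteq> 0"
    and unimodular: "norm u = 1"
    and f_quotient: "\<And>z. poly p z \<noteq> 0 \<Longrightarrow> f z = u * poly (reflection m p) z / poly p z"
  shows "dirichlet_norm_sq P f \<le>
    ennreal (blaschke_dirichlet_const P m) * (1 + circle_norm_powr P (deriv f))"
proof -
  obtain v as where blaschke: "norm v = 1" "length as \<le> m" "\<And>a. a \<in> set as \<Longrightarrow> norm a < 1"
    "\<And>a z. \<lbrakk>a \<in> set as; poly p z \<noteq> 0\<rbrakk> \<Longrightarrow> 1 - cnj a * z \<noteq> 0"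
    "\<And>z. poly p z \<noteq> 0 \<Longrightarrow> poly (reflection m p) z = v * blaschke as z * poly p z"
    using is_blaschke_quotient_reflection[OF degree nonzero] unfolding is_blaschke_quotient_def by blast
  have unimodular_mult: "norm (u * v) = 1" using unimodular blaschke(1) by (simp add: norm_mult)
  have f_eq: "\<forall>\<^sub>F y in nhds z. f y = u * v * blaschke as y" if "poly p z \<noteq> 0" for z
    by (rule eventually_mono[OF eventually_nhds_in_open[of "{z. poly p z \<noteq> 0}"]])
       (use that f_quotient blaschke(5) in \<open>auto intro!: open_Collect_neq continuous_intros\<close>)
  have "blaschke as holomorphic_on ball 0 1"
    by (intro holomorphic_on_blaschke blaschke(4) nonzero) auto
  then have "blaschke as analytic_on {0}" by (rule holomorphic_on_imp_analytic_at) auto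
  then have dirichlet: "dirichlet_norm_sq P f = dirichlet_norm_sq P (blaschke as)"
    by (intro dirichlet_norm_sq_unimodular_mult[OF f_eq unimodular_mult] nonzero) auto
  have "p \<noteq> 0" using nonzero[of 0] by auto
  have deriv: "norm (deriv f z) = norm (deriv (blaschke as) z)" if "poly p z \<noteq> 0" for z
    by (intro norm_deriv_unimodular_mult[OF f_eq unimodular_mult] blaschke_field_differentiable
          blaschke(4) that)
  have "circle_norm_powr P (deriv f) = circle_norm_powr P (deriv (blaschke as))"
    unfolding circle_norm_powr_def
    by (intro nn_integral_cong_AE eventually_mono[OF AE_cis_poly_nonzero[OF \<open>p \<noteq> 0\<close>]])
       (use deriv in metis)
  then show ?thesis
    using blaschke_dirichlet_norm_sq_le_circle_norm[OF P_nonneg blaschke(3,2)] dirichlet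
    by (simp only:)
qed

subsection \<open>Hardy and Dirichlet spaces of the bidisc\<close>

definition torus_powr :: "real \<Rightarrow> (complex \<Rightarrow> complex \<Rightarrow> complex) \<Rightarrow> real \<Rightarrow> real \<Rightarrow> real \<Rightarrow> real" where
  "torus_powr P f r s t = norm (f (of_real r * cis s) (of_real r * cis t)) powr P"

lemma hardy2_iff:
  "hardy2 P f \<longleftrightarrow> holo_bidisc f \<and>
     bdd_above ((\<lambda>r. 1 / (4 * pi ^ 2) *
       (LBINT s=0..2*pi. (LBINT t=0..2*pi. torus_powr P f r s t))) ` {0<..<1})"
  by (simp only: hardy2_def torus_powr_def)

lemma continuous_on_torus_powr:
  assumes holo: "holo_bidisc f" and radius: "0 < r" "r < 1" and P_pos: "0 < P"
  shows "continuous_on UNIV (\<lambda>(s, t). torus_powr P f r s t)"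
proof -
  have "continuous_on UNIV
      (\<lambda>x. case (of_real r * cis (fst x), of_real r * cis (snd x)) of (z, w) \<Rightarrow> f z w)"
    by (rule continuous_on_compose2[of "ball 0 1 \<times> ball 0 1"])
       (use holo radius in \<open>auto simp: holo_bidisc_def norm_mult intro!: continuous_intros\<close>)
  then show ?thesis
    unfolding torus_powr_def case_prod_unfold
    using P_pos by (intro continuous_on_powr' continuous_intros) auto
qed

lemma iterated_LBINT_eq_integral:
  fixes F :: "real \<Rightarrow> real \<Rightarrow> real"
  assumes cont_F: "continuous_on UNIV (\<lambda>(s, t). F s t)"
  shows "(LBINT s=0..2*pi. (LBINT t=0..2*pi. F s t)) = integral {0..2*pi} (\<lambda>s. integral {0..2*pi} (F s))"
    and "continuous_on {0..2*pi} (F s)"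
    and "continuous_on {0..2*pi} (\<lambda>s. integral {0..2*pi} (F s))"
proof -
  show cont: "continuous_on {0..2*pi} (F s)" for s
    using continuous_on_compose2[OF cont_F, of "{0..2*pi}" "\<lambda>t. (s, t)"]
    by (simp add: continuous_intros)
  show cont_integral: "continuous_on {0..2*pi} (\<lambda>s. integral {0..2*pi} (F s))"
    using integral_continuous_on_param[of "{0..2*pi}" 0 "2*pi" F]
      continuous_on_subset[OF cont_F, of "{0..2*pi} \<times> {0..2*pi}"] by simp
  have LBINT_eq: "(LBINT t=0..2*pi. h t) = integral {0..2*pi} h" if "continuous_on {0..2*pi} h"
    for h :: "real \<Rightarrow> real"
    using interval_integral_eq_integral[of 0 "2*pi" h] borel_integrable_atLeastAtMost'[OF that]
    by (simp add: zero_ereal_def)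
  show "(LBINT s=0..2*pi. (LBINT t=0..2*pi. F s t)) = integral {0..2*pi} (\<lambda>s. integral {0..2*pi} (F s))"
    by (simp add: LBINT_eq cont cont_integral)
qed

lemma torus_nn_integral_eq_LBINT:
  fixes F :: "real \<Rightarrow> real \<Rightarrow> real"
  assumes cont_F: "continuous_on UNIV (\<lambda>(s, t). F s t)" and nonneg: "\<And>s t. 0 \<le> F s t"
  shows "(\<lambda>(s, t). ennreal (F s t)) \<in> borel_measurable torus_measure"
    and "(\<integral>\<^sup>+(s, t). ennreal (F s t) \<partial>torus_measure) =
      ennreal (LBINT s=0..2*pi. (LBINT t=0..2*pi. F s t))"
proof -
  note integral = iterated_LBINT_eq_integral[OF cont_F]
  have "fst \<in> borel_measurable torus_measure" "snd \<in> borel_measurable torus_measure"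
    by (intro measurable_compose[OF measurable_fst] measurable_compose[OF measurable_snd]
        borel_measurable_angle_measure measurable_ident_sets refl)+
  then have "(\<lambda>x. F (fst x) (snd x)) \<in> borel_measurable torus_measure"
    by (rule borel_measurable_continuous_Pair) (use cont_F in \<open>simp add: case_prod_unfold\<close>)
  then show meas: "(\<lambda>(s, t). ennreal (F s t)) \<in> borel_measurable torus_measure"
    unfolding case_prod_unfold by measurable
  have "(\<integral>\<^sup>+(s, t). ennreal (F s t) \<partial>torus_measure) =
      (\<integral>\<^sup>+s. (\<integral>\<^sup>+t. ennreal (F s t) \<partial>angle_measure) \<partial>angle_measure)"
    using angle.nn_integral_fst[OF meas] by simp
  also have "\<dots> = (\<integral>\<^sup>+s. ennreal (integral {0..2*pi} (F s)) \<partial>angle_measure)"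
    by (intro nn_integral_cong nn_integral_angle_measure_continuous integral nonneg)
  also have "\<dots> = ennreal (LBINT s=0..2*pi. (LBINT t=0..2*pi. F s t))"
    unfolding integral(1)
    by (intro nn_integral_angle_measure_continuous integral integral_nonneg
          integrable_continuous_interval nonneg)
  finally show "(\<integral>\<^sup>+(s, t). ennreal (F s t) \<partial>torus_measure) =
      ennreal (LBINT s=0..2*pi. (LBINT t=0..2*pi. F s t))" .
qed

lemma hardy2_swap:
  assumes hardy: "hardy2 P f" and P_pos: "0 < P"
  shows "hardy2 P (\<lambda>z w. f w z)"
proof -
  let ?J = "\<lambda>f r. LBINT s=0..2*pi. (LBINT t=0..2*pi. torus_powr P f r s t)"
  have holo: "holo_bidisc f" and holo_swap: "holo_bidisc (\<lambda>z w. f w z)"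
    using hardy by (simp_all add: hardy2_iff holo_bidisc_swap)
  have "?J (\<lambda>z w. f w z) r = ?J f r" if "r \<in> {0<..<1}" for r
  proof -
    have radius: "0 < r" "r < 1" using that by auto
    note cont = continuous_on_torus_powr[OF holo radius P_pos]
    have "torus_powr P (\<lambda>z w. f w z) r s t = torus_powr P f r t s" for s t
      by (simp add: torus_powr_def)
    then have "?J (\<lambda>z w. f w z) r =
        integral {0..2*pi} (\<lambda>s. integral {0..2*pi} (\<lambda>t. torus_powr P f r t s))"
      using iterated_LBINT_eq_integral(1)[OF continuous_on_torus_powr[OF holo_swap radius P_pos]] by simp
    also have "\<dots> = ?J f r"
      using integral_swap_continuous[of 0 0 "2*pi" "2*pi" "torus_powr P f r"]
        continuous_on_subset[OF cont] iterated_LBINT_eq_integral(1)[OF cont] by simp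
    finally show ?thesis .
  qed
  then have "(\<lambda>r. 1 / (4 * pi ^ 2) * ?J (\<lambda>z w. f w z) r) ` {0<..<1} =
      (\<lambda>r. 1 / (4 * pi ^ 2) * ?J f r) ` {0<..<1}"
    by (intro image_cong refl) (simp only:)
  then show ?thesis using hardy holo_swap by (simp only: hardy2_iff)
qed

lemma dirichlet2_swap:
  assumes dirichlet: "dirichlet2 a b f"
  shows "dirichlet2 b a (\<lambda>z w. f w z)"
proof -
  have holo: "holo_bidisc f" using dirichlet by (simp add: dirichlet2_def)
  let ?g = "\<lambda>(k, l). (real k + 1) powr a * (real l + 1) powr b * (norm (taylor2 f k l))\<^sup>2"
  have "?g summable_on prod.swap ` UNIV" using dirichlet by (simp add: dirichlet2_def)
  then have "(?g \<circ> prod.swap) summable_on UNIV" by (subst (asm) summable_on_reindex) auto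
  then show ?thesis
    using holo_bidisc_swap[OF holo]
    by (simp add: dirichlet2_def taylor2_swap[OF holo] o_def case_prod_unfold mult.commute)
qed

lemma hardy2_nn_integral_bounded:
  assumes hardy: "hardy2 P f" and P_pos: "0 < P"
  obtains M :: real where
    "\<And>r. \<lbrakk>0 < r; r < 1\<rbrakk> \<Longrightarrow> (\<integral>\<^sup>+(s, t). ennreal (torus_powr P f r s t) \<partial>torus_measure) \<le> ennreal M"
proof -
  define J where "J = (\<lambda>r. LBINT s=0..2*pi. (LBINT t=0..2*pi. torus_powr P f r s t))"
  have holo: "holo_bidisc f" and "bdd_above ((\<lambda>r. 1 / (4 * pi ^ 2) * J r) ` {0<..<1})"
    using hardy by (simp_all only: hardy2_iff J_def)
  then obtain B where bound: "\<And>r. r \<in> {0<..<1} \<Longrightarrow> 1 / (4 * pi ^ 2) * J r \<le> B"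
    unfolding bdd_above_def by blast
  show ?thesis
  proof (rule that)
    fix r :: real assume radius: "0 < r" "r < 1"
    have "(\<integral>\<^sup>+(s, t). ennreal (torus_powr P f r s t) \<partial>torus_measure) = ennreal (J r)"
      unfolding J_def
      by (rule torus_nn_integral_eq_LBINT(2)[OF continuous_on_torus_powr[OF holo radius P_pos]])
         (simp add: torus_powr_def)
    also have "\<dots> \<le> ennreal (4 * pi ^ 2 * B)"
      using bound[of r] radius by (intro ennreal_leI) (simp add: pos_divide_le_eq mult.commute)
    finally show "(\<integral>\<^sup>+(s, t). ennreal (torus_powr P f r s t) \<partial>torus_measure) \<le>
        ennreal (4 * pi ^ 2 * B)" .
  qed
qed

lemma hardy2_radial_limit:
  assumes hardy: "hardy2 P f" and P_pos: "0 < P"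
  obtains g :: "real \<times> real \<Rightarrow> ennreal" where
    "g \<in> borel_measurable torus_measure" "(\<integral>\<^sup>+x. g x \<partial>torus_measure) < \<infinity>"
    "\<And>s t L. ((\<lambda>r. f (of_real r * cis s) (of_real r * cis t)) \<longlongrightarrow> L) (at_left 1) \<Longrightarrow>
       g (s, t) = ennreal (norm L powr P)"
proof -
  have holo: "holo_bidisc f" using hardy by (simp add: hardy2_iff)
  obtain M :: real where bound:
    "\<And>r. \<lbrakk>0 < r; r < 1\<rbrakk> \<Longrightarrow> (\<integral>\<^sup>+(s, t). ennreal (torus_powr P f r s t) \<partial>torus_measure) \<le> ennreal M"
    using hardy2_nn_integral_bounded[OF hardy P_pos] by blast
  define r where "r = (\<lambda>i. 1 - inverse (real (Suc (Suc i))))"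
  have radii: "0 < r i" "r i < 1" for i by (simp_all add: r_def inverse_less_1_iff)
  have "r \<longlonglongrightarrow> 1 - 0"
    unfolding r_def by (intro tendsto_diff tendsto_const LIMSEQ_Suc[OF LIMSEQ_inverse_real_of_nat])
  then have r_lim: "filterlim r (at_left 1) sequentially"
    using less_imp_neq[OF radii(2)] radii by (auto simp: filterlim_at)
  define u where "u = (\<lambda>i (s, t). ennreal (torus_powr P f (r i) s t))"
  have meas_u: "u i \<in> borel_measurable torus_measure" for i
    unfolding u_def
    by (rule torus_nn_integral_eq_LBINT(1)[OF continuous_on_torus_powr[OF holo radii P_pos]])
       (simp add: torus_powr_def)
  show ?thesis
  proof (rule that[of "\<lambda>x. liminf (\<lambda>i. u i x)"])
    have "(\<integral>\<^sup>+x. liminf (\<lambda>i. u i x) \<partial>torus_measure) \<le>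
        liminf (\<lambda>i. \<integral>\<^sup>+x. u i x \<partial>torus_measure)"
      by (rule nn_integral_liminf[OF meas_u])
    also have "\<dots> \<le> ennreal M"
      using bound[OF radii] by (intro Liminf_le always_eventually allI) (simp_all add: u_def)
    finally show "(\<integral>\<^sup>+x. liminf (\<lambda>i. u i x) \<partial>torus_measure) < \<infinity>"
      by (simp add: order_le_less_trans)
    fix s t L assume "((\<lambda>r. f (of_real r * cis s) (of_real r * cis t)) \<longlongrightarrow> L) (at_left 1)"
    then have "(\<lambda>i. u i (s, t)) \<longlonglongrightarrow> ennreal (norm L powr P)"
      unfolding u_def torus_powr_def prod.case using P_pos
      by (intro tendsto_ennrealI tendsto_powr' tendsto_norm tendsto_const filterlim_compose[OF _ r_lim])
         auto
    then show "liminf (\<lambda>i. u i (s, t)) = ennreal (norm L powr P)" by (intro lim_imp_Liminf) auto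
  qed (intro borel_measurable_liminf meas_u)
qed

lemma summable_on_prod_of_suminf_ennreal:
  fixes F :: "nat \<Rightarrow> nat \<Rightarrow> real"
  assumes nonneg: "\<And>k l. 0 \<le> F k l" and finite: "(\<Sum>k. \<Sum>l. ennreal (F k l)) < \<infinity>"
  shows "(\<lambda>(k, l). F k l) summable_on UNIV"
proof (rule nonneg_bdd_above_summable_on)
  obtain S where S_eq: "0 \<le> S" "(\<Sum>k. \<Sum>l. ennreal (F k l)) = ennreal S"
    using finite by (cases "\<Sum>k. \<Sum>l. ennreal (F k l)") auto
  show "bdd_above (sum (\<lambda>(k, l). F k l) ` {A. A \<subseteq> UNIV \<and> finite A})"
  proof (rule bdd_aboveI2)
    fix A :: "(nat \<times> nat) set" assume "A \<in> {A. A \<subseteq> UNIV \<and> finite A}"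
    then have finite_A: "finite A" by simp
    obtain K L where "fst ` A \<subseteq> {..<K}" "snd ` A \<subseteq> {..<L}"
      using finite_nat_bounded[of "fst ` A"] finite_nat_bounded[of "snd ` A"] finite_A by auto
    then have "A \<subseteq> {..<K} \<times> {..<L}" by force
    then have "(\<Sum>(k, l)\<in>A. F k l) \<le> (\<Sum>k<K. \<Sum>l<L. F k l)"
      unfolding sum.cartesian_product by (intro sum_mono2) (auto simp: nonneg)
    then have "ennreal (\<Sum>(k, l)\<in>A. F k l) \<le> ennreal (\<Sum>k<K. \<Sum>l<L. F k l)" by (rule ennreal_leI)
    also have "\<dots> \<le> (\<Sum>k<K. \<Sum>l. ennreal (F k l))"
      using nonneg by (auto simp: sum_nonneg simp flip: sum_ennreal intro!: sum_mono sum_le_suminf)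
    also have "\<dots> \<le> ennreal S" unfolding S_eq(2)[symmetric] by (intro sum_le_suminf) auto
    finally show "(\<Sum>(k, l)\<in>A. F k l) \<le> S" using ennreal_le_iff[OF S_eq(1)] by blast
  qed
qed (use nonneg in auto)

lemma dirichlet2_of_slices:
  assumes holo: "holo_bidisc f" and rho: "1 < \<rho>"
    and coeff: "\<And>k. (\<lambda>w. taylor_coeff (\<lambda>z. f z w) k) holomorphic_on ball 0 \<rho>"
    and finite: "(\<integral>\<^sup>+t. dirichlet_norm_sq P (\<lambda>z. f z (cis t)) \<partial>angle_measure) < \<infinity>"
  shows "dirichlet2 P 0 f"
proof -
  define a where "a = (\<lambda>k w. taylor_coeff (\<lambda>z. f z w) k)"
  have taylor2: "taylor2 f k l = taylor_coeff (a k) l" for k l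
    using taylor2_eq_iterated_taylor_coeff[OF holo_bidisc_swap[OF holo]] taylor2_swap[OF holo]
    by (simp add: a_def)
  have holo_a: "a k holomorphic_on ball 0 \<rho>" for k using coeff by (simp add: a_def)
  have "(\<lambda>t. a k (cis t)) \<in> borel_measurable angle_measure" for k
    using continuous_on_circle[OF holo_a[of k], of 1 UNIV] rho
    by (intro borel_measurable_angle_measure borel_measurable_continuous_onI) simp
  then have meas: "(\<lambda>t. ennreal ((norm (a k (cis t)))\<^sup>2)) \<in> borel_measurable angle_measure" for k
    by measurable
  have "dirichlet_norm_sq P (\<lambda>z. f z (cis t)) =
      (\<Sum>k. ennreal ((real k + 1) powr P) * ennreal ((norm (a k (cis t)))\<^sup>2))" for t
    by (simp add: dirichlet_norm_sq_def a_def ennreal_mult')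
  then have "(\<integral>\<^sup>+t. dirichlet_norm_sq P (\<lambda>z. f z (cis t)) \<partial>angle_measure) =
      (\<Sum>k. \<integral>\<^sup>+t. ennreal ((real k + 1) powr P) * ennreal ((norm (a k (cis t)))\<^sup>2) \<partial>angle_measure)"
    by (simp only:
        nn_integral_suminf[OF borel_measurable_times_ennreal[OF borel_measurable_const meas]])
  also have "\<dots> = (\<Sum>k. ennreal ((real k + 1) powr P) * (\<Sum>l. ennreal (2 * pi * (norm (taylor2 f k l))\<^sup>2)))"
    by (simp only: nn_integral_cmult[OF meas] parseval_unit_circle[OF holo_a rho] taylor2)
  also have "\<dots> = (\<Sum>k. \<Sum>l. ennreal (2 * pi * ((real k + 1) powr P * (norm (taylor2 f k l))\<^sup>2)))"
    unfolding ennreal_suminf_cmult[symmetric] ennreal_mult'[OF powr_ge_zero, symmetric]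
    by (simp only: mult_ac)
  finally have "(\<lambda>(k, l). 2 * pi * ((real k + 1) powr P * (norm (taylor2 f k l))\<^sup>2)) summable_on UNIV"
    using finite by (intro summable_on_prod_of_suminf_ennreal) auto
  from summable_on_cmult_right[OF this, of "1 / (2 * pi)"] show ?thesis
    using holo by (simp add: dirichlet2_def case_prod_unfold)
qed

subsection \<open>Slices of bivariate polynomials\<close>

definition slice_poly :: "(nat \<Rightarrow> nat \<Rightarrow> complex) \<Rightarrow> nat \<Rightarrow> nat \<Rightarrow> complex \<Rightarrow> complex poly" where
  "slice_poly c m n w = (\<Sum>j\<le>m. monom (\<Sum>k\<le>n. c j k * w ^ k) j)"

lemma coeff_slice_poly: "coeff (slice_poly c m n w) j = (if j \<le> m then \<Sum>k\<le>n. c j k * w ^ k else 0)"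
  by (simp add: slice_poly_def coeff_sum coeff_monom sum.delta')

lemma poly_slice_poly: "poly (slice_poly c m n w) z = bipoly c m n z w"
  unfolding slice_poly_def bipoly_def poly_sum poly_monom sum_distrib_right by (simp add: mult_ac)

lemma degree_slice_poly_le: "degree (slice_poly c m n w) \<le> m"
  by (rule degree_le) (simp add: coeff_slice_poly)

lemma slice_poly_refl_coeff:
  assumes "norm w = 1"
  shows "slice_poly (refl_coeff c m n) m n w = smult (w ^ n) (reflection m (slice_poly c m n w))"
proof (rule poly_eqI)
  fix j
  have "w * cnj w = 1" using assms by (simp flip: complex_norm_square)
  then have power: "w ^ n * cnj w ^ k = w ^ (n - k)" if "k \<le> n" for k
  proof -
    have "w ^ n * cnj w ^ k = w ^ (n - k) * (w * cnj w) ^ k"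
      using that by (simp add: power_mult_distrib flip: power_add mult.assoc)
    then show ?thesis by (simp add: \<open>w * cnj w = 1\<close>)
  qed
  have "(\<Sum>k\<le>n. cnj (c (m - j) (n - k)) * w ^ k) = w ^ n * cnj (\<Sum>k\<le>n. c (m - j) k * w ^ k)"
  proof -
    have "(\<Sum>k\<le>n. cnj (c (m - j) (n - k)) * w ^ k) = (\<Sum>k\<le>n. cnj (c (m - j) k) * w ^ (n - k))"
      by (rule sum.reindex_bij_witness[of _ "\<lambda>k. n - k" "\<lambda>k. n - k"]) auto
    also have "\<dots> = w ^ n * cnj (\<Sum>k\<le>n. c (m - j) k * w ^ k)"
      unfolding cnj_sum sum_distrib_left by (intro sum.cong) (auto simp: mult_ac simp flip: power)
    finally show ?thesis .
  qed
  then show "coeff (slice_poly (refl_coeff c m n) m n w) j =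
      coeff (smult (w ^ n) (reflection m (slice_poly c m n w))) j"
    by (simp add: coeff_slice_poly coeff_reflection refl_coeff_def)
qed

lemma is_polyfun_sum_poly:
  fixes R :: "nat \<Rightarrow> complex poly"
  shows "is_polyfun (\<lambda>z w. \<Sum>j\<le>m. poly (R j) w * z ^ j)"
proof -
  define N where "N = m + (\<Sum>j\<le>m. degree (R j))"
  define d where "d = (\<lambda>j k. if j \<le> m then coeff (R j) k else 0)"
  have "poly (R j) w = (\<Sum>k\<le>N. d j k * w ^ k)" if "j \<le> m" for j w
  proof -
    have "degree (R j) \<le> (\<Sum>j\<le>m. degree (R j))" using that by (intro member_le_sum) auto
    then show ?thesis unfolding poly_altdef
      by (intro sum.mono_neutral_cong_left) (use that in \<open>auto simp: N_def d_def intro: coeff_eq_0\<close>)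
  qed
  then have "(\<Sum>j\<le>m. poly (R j) w * z ^ j) = (\<Sum>j\<le>N. (\<Sum>k\<le>N. d j k * w ^ k) * z ^ j)" for z w
    by (intro sum.mono_neutral_cong_left) (auto simp: N_def d_def)
  also have "(\<Sum>j\<le>N. (\<Sum>k\<le>N. d j k * w ^ k) * z ^ j) = bipoly d N N z w" for z w
    unfolding bipoly_def sum_distrib_right by (simp add: mult_ac)
  finally show ?thesis unfolding is_polyfun_def by blast
qed

lemma bipoly_factor_linear:
  assumes "slice_poly c m n w0 = 0"
  obtains r where "is_polyfun r" "\<And>z w. bipoly c m n z w = (w - w0) * r z w"
proof -
  define Q where "Q = (\<lambda>j. \<Sum>k\<le>n. monom (c j k) k)"
  have bipoly: "bipoly c m n z w = (\<Sum>j\<le>m. poly (Q j) w * z ^ j)" for z w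
    unfolding Q_def bipoly_def poly_sum poly_monom sum_distrib_right by (simp add: mult_ac)
  have "[:-w0, 1:] dvd Q j" if "j \<le> m" for j
    using arg_cong[OF assms, of "\<lambda>p. coeff p j"] that
    by (simp add: coeff_slice_poly Q_def poly_sum poly_monom flip: poly_eq_0_iff_dvd)
  then have "\<forall>j. \<exists>R. j \<le> m \<longrightarrow> Q j = [:-w0, 1:] * R" unfolding dvd_def by blast
  then obtain R where factor: "\<And>j. j \<le> m \<Longrightarrow> Q j = [:-w0, 1:] * R j" by metis
  show ?thesis
  proof (rule that[OF is_polyfun_sum_poly[of R m]])
    show "bipoly c m n z w = (w - w0) * (\<Sum>j\<le>m. poly (R j) w * z ^ j)" for z w
      unfolding bipoly sum_distrib_left by (intro sum.cong) (auto simp: factor algebra_simps)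
  qed
qed

lemma atoral_slice_poly_nonzero:
  assumes "atoral c m n" and circle: "norm w0 = 1"
  shows "slice_poly c m n w0 \<noteq> 0"
proof
  assume zero: "slice_poly c m n w0 = 0"
  then have "slice_poly (refl_coeff c m n) m n w0 = 0"
    unfolding slice_poly_refl_coeff[OF circle] by (simp add: reflection_def)
  then obtain s where factor_refl: "is_polyfun s"
      "\<And>z w. bipoly (refl_coeff c m n) m n z w = (w - w0) * s z w"
    using bipoly_factor_linear by blast
  obtain r where factor: "is_polyfun r" "\<And>z w. bipoly c m n z w = (w - w0) * r z w"
    using bipoly_factor_linear[OF zero] by blast
  have "is_polyfun (\<lambda>z w. w - w0)" using is_polyfun_sum_poly[of "\<lambda>_. [:-w0, 1:]" 0] by simp
  moreover have "\<nexists>a. \<forall>z w :: complex. w - w0 = a"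
    by (metis add_diff_cancel_right' diff_self zero_neq_one)
  ultimately show False using assms(1) factor factor_refl unfolding atoral_def by blast
qed

lemma continuous_on_bipoly [continuous_intros]:
  assumes "continuous_on S f" "continuous_on S g"
  shows "continuous_on S (\<lambda>x. bipoly c m n (f x) (g x))"
  unfolding bipoly_def by (intro continuous_intros assms)

lemma holomorphic_on_bipoly [holomorphic_intros]:
  assumes "f holomorphic_on S" "g holomorphic_on S"
  shows "(\<lambda>x. bipoly c m n (f x) (g x)) holomorphic_on S"
  unfolding bipoly_def by (intro holomorphic_intros assms)

lemma uniform_limit_compact_param:
  fixes h :: "'a::topological_space \<Rightarrow> 'b::topological_space \<Rightarrow> 'c::metric_space"
  assumes cont: "continuous_on (UNIV \<times> K) (\<lambda>(x, z). h x z)" and compact_K: "compact K"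
    and lim: "(y \<longlongrightarrow> x) F"
  shows "uniform_limit K (\<lambda>i. h (y i)) (h x) F"
proof (rule uniform_limitI)
  fix e :: real assume "0 < e"
  then obtain X where nbhd: "x \<in> X" "open X" "\<forall>x'\<in>X \<inter> UNIV. \<forall>z\<in>K. dist (h x' z) (h x z) \<le> e / 2"
    using continuous_on_prod_compactE[OF cont compact_K UNIV_I, of "e / 2"]
    by (auto simp: case_prod_unfold)
  then have "\<forall>\<^sub>F i in F. y i \<in> X" using lim by (simp add: topological_tendstoD)
  then show "\<forall>\<^sub>F i in F. \<forall>z\<in>K. dist (h (y i) z) (h x z) < e"
    by eventually_elim (use nbhd(3) \<open>0 < e\<close> in force)
qed

lemma bipoly_nonzero_boundary_slice:
  assumes no_zeros: "no_zeros_bidisc c m n" and slice: "slice_poly c m n w \<noteq> 0"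
    and circle: "norm w = 1" and in_disc: "norm z < 1"
  shows "bipoly c m n z w \<noteq> 0"
proof
  assume zero: "bipoly c m n z w = 0"
  define r where "r = (\<lambda>i. 1 - inverse (real (Suc i)))"
  have radii: "0 \<le> r i" "r i < 1" for i by (simp_all add: r_def inverse_le_1_iff)
  have "bipoly c m n z w \<noteq> 0"
  proof (rule Hurwitz_no_zeros[where S = "ball 0 1" and g = "\<lambda>z. bipoly c m n z w"
        and \<F> = "\<lambda>i z. bipoly c m n z (of_real (r i) * w)"])
    show "uniform_limit K (\<lambda>i z. bipoly c m n z (of_real (r i) * w)) (\<lambda>z. bipoly c m n z w) sequentially"
      if "compact K" for K
    proof (rule uniform_limit_compact_param[OF _ that, where h = "\<lambda>v z. bipoly c m n z v"])
      have "r \<longlonglongrightarrow> 1 - 0"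
        unfolding r_def by (intro tendsto_diff tendsto_const LIMSEQ_inverse_real_of_nat)
      from tendsto_mult[OF tendsto_of_real[OF this] tendsto_const[of w]]
      show "(\<lambda>i. of_real (r i) * w) \<longlonglongrightarrow> w" by simp
    qed (auto simp: case_prod_unfold intro!: continuous_intros)
    show "bipoly c m n v (of_real (r i) * w) \<noteq> 0" if "v \<in> ball 0 1" for i v
      using no_zeros that circle radii[of i] by (simp add: no_zeros_bidisc_def norm_mult)
    show "\<not> (\<lambda>z. bipoly c m n z w) constant_on ball 0 1"
    proof
      assume "(\<lambda>z. bipoly c m n z w) constant_on ball 0 1"
      then have "ball 0 1 \<subseteq> {z. poly (slice_poly c m n w) z = 0}"
        using zero in_disc by (auto simp: constant_on_def poly_slice_poly)
      then have "finite (ball (0::complex) 1)"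
        using poly_roots_finite[OF slice] finite_subset by blast
      then show False using uncountable_ball countable_finite by (metis zero_less_one)
    qed
  qed (use in_disc in \<open>auto intro!: holomorphic_intros\<close>)
  then show False using zero by contradiction
qed

lemma atoral_bipoly_nonzero:
  assumes no_zeros: "no_zeros_bidisc c m n" and atoral: "atoral c m n" and in_disc: "norm z < 1"
    and closed_disc: "norm w \<le> 1"
  shows "bipoly c m n z w \<noteq> 0"
  using bipoly_nonzero_boundary_slice[OF no_zeros atoral_slice_poly_nonzero[OF atoral]]
    no_zeros in_disc closed_disc
  by (cases "norm w = 1") (auto simp: no_zeros_bidisc_def)

subsection \<open>Rational inner functions\<close>

definition rational_inner :: "(nat \<Rightarrow> nat \<Rightarrow> complex) \<Rightarrow> nat \<Rightarrow> nat \<Rightarrow> complex \<Rightarrow> complex \<Rightarrow> complex" where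
  "rational_inner c m n z w = bipoly (refl_coeff c m n) m n z w / bipoly c m n z w"

lemma holo_bidisc_rational_inner:
  assumes "no_zeros_bidisc c m n"
  shows "holo_bidisc (rational_inner c m n)"
  unfolding holo_bidisc_def rational_inner_def [abs_def] case_prod_unfold
  using assms
  by (intro conjI ballI continuous_intros holomorphic_intros) (auto simp: no_zeros_bidisc_def)

lemma open_Collect_ball_compact:
  assumes "compact K" "open U"
  shows "open {x. \<forall>z\<in>K. (x, z) \<in> U}"
  unfolding open_subopen[of "{x. _ x}"]
proof (intro ballI)
  fix x assume "x \<in> {x. \<forall>z\<in>K. (x, z) \<in> U}"
  then have "{x} \<times> K \<subseteq> U" by auto
  then obtain X where "x \<in> X" "open X" "X \<times> K \<subseteq> U"
    using Elementary_Topology.tube_lemma[OF assms] by blast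
  then show "\<exists>T. open T \<and> x \<in> T \<and> T \<subseteq> {x. \<forall>z\<in>K. (x, z) \<in> U}" by (intro exI[of _ X]) auto
qed

lemma cball_subset_open_imp_larger_ball:
  fixes a :: "'a::heine_borel"
  assumes "open U" "cball a r \<subseteq> U"
  obtains \<rho> where "r < \<rho>" "ball a \<rho> \<subseteq> U"
proof (cases "U = UNIV")
  case False
  then obtain x where "x \<in> -U" "\<And>y. y \<in> -U \<Longrightarrow> dist a x \<le> dist a y"
    using distance_attains_inf[of "-U" a] assms(1) by auto
  then show ?thesis using assms(2) by (intro that[of "dist a x"]) force+
qed (use that[of "r + 1"] in auto)

lemma rational_inner_taylor_coeff_holomorphic:
  assumes nonzero: "\<And>z w. \<lbrakk>norm z < 1; norm w \<le> 1\<rbrakk> \<Longrightarrow> bipoly c m n z w \<noteq> 0"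
  obtains \<rho> where "1 < \<rho>"
    "\<And>k. (\<lambda>w. taylor_coeff (\<lambda>z. rational_inner c m n z w) k) holomorphic_on ball 0 \<rho>"
proof -
  define W where "W = {w. \<forall>z\<in>cball 0 (1/2). (w, z) \<in> {(w, z). bipoly c m n z w \<noteq> 0}}"
  have "open W"
    unfolding W_def case_prod_unfold
    by (intro open_Collect_ball_compact compact_cball open_Collect_neq continuous_intros)
  have holo: "(\<lambda>w. taylor_coeff (\<lambda>z. rational_inner c m n z w) k) holomorphic_on W" for k
    by (rule holomorphic_on_taylor_coeff_param[OF \<open>open W\<close>, of "1/2"])
       (auto simp: W_def rational_inner_def case_prod_unfold intro!: continuous_intros holomorphic_intros)
  have "cball 0 1 \<subseteq> W" using nonzero by (auto simp: W_def)
  then obtain \<rho> where "1 < \<rho>" "ball 0 \<rho> \<subseteq> W"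
    using cball_subset_open_imp_larger_ball[OF \<open>open W\<close>] by blast
  then show ?thesis using that holomorphic_on_subset[OF holo] by blast
qed

definition bipoly_deriv1 :: "(nat \<Rightarrow> nat \<Rightarrow> complex) \<Rightarrow> nat \<Rightarrow> nat \<Rightarrow> complex \<Rightarrow> complex \<Rightarrow> complex" where
  "bipoly_deriv1 c m n z w = (\<Sum>j\<le>m. \<Sum>k\<le>n. c j k * (of_nat j * z ^ (j - 1)) * w ^ k)"

lemma bipoly_has_derivative:
  "((\<lambda>z. bipoly c m n z w) has_field_derivative bipoly_deriv1 c m n z w) (at z)"
  unfolding bipoly_def bipoly_deriv1_def by (auto intro!: derivative_eq_intros sum.cong)

lemma tendsto_bipoly:
  assumes "(f \<longlongrightarrow> z) F" "(g \<longlongrightarrow> w) F"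
  shows "((\<lambda>x. bipoly c m n (f x) (g x)) \<longlongrightarrow> bipoly c m n z w) F"
    and "((\<lambda>x. bipoly_deriv1 c m n (f x) (g x)) \<longlongrightarrow> bipoly_deriv1 c m n z w) F"
  unfolding bipoly_def bipoly_deriv1_def by (intro tendsto_intros assms)+

lemma tendsto_d1_rational_inner:
  assumes lim: "(f \<longlongrightarrow> z) F" "(g \<longlongrightarrow> w) F" and nonzero: "bipoly c m n z w \<noteq> 0"
  shows "((\<lambda>x. d1 (rational_inner c m n) (f x) (g x)) \<longlongrightarrow> d1 (rational_inner c m n) z w) F"
proof -
  define D where "D = (\<lambda>z w. (bipoly_deriv1 (refl_coeff c m n) m n z w * bipoly c m n z w -
    bipoly (refl_coeff c m n) m n z w * bipoly_deriv1 c m n z w) /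
    (bipoly c m n z w * bipoly c m n z w))"
  have d1: "d1 (rational_inner c m n) z w = D z w" if "bipoly c m n z w \<noteq> 0" for z w
    unfolding d1_def rational_inner_def D_def
    by (rule DERIV_imp_deriv[OF DERIV_divide[OF bipoly_has_derivative bipoly_has_derivative that]])
  have "((\<lambda>x. D (f x) (g x)) \<longlongrightarrow> D z w) F"
    unfolding D_def using nonzero by (intro tendsto_intros tendsto_bipoly lim) auto
  moreover have "\<forall>\<^sub>F x in F. bipoly c m n (f x) (g x) \<noteq> 0"
    by (rule tendsto_imp_eventually_ne[OF tendsto_bipoly(1)[OF lim] nonzero])
  then have "\<forall>\<^sub>F x in F. D (f x) (g x) = d1 (rational_inner c m n) (f x) (g x)"
    by eventually_elim (simp add: d1)
  ultimately show ?thesis unfolding d1[OF nonzero] by (rule Lim_transform_eventually)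
qed

lemma rational_inner_slice_dirichlet_norm_sq_le:
  assumes P_nonneg: "0 \<le> P" and circle: "norm w = 1"
    and nonzero: "\<And>z. norm z < 1 \<Longrightarrow> bipoly c m n z w \<noteq> 0"
  shows "dirichlet_norm_sq P (\<lambda>z. rational_inner c m n z w) \<le>
    ennreal (blaschke_dirichlet_const P m) *
    (1 + circle_norm_powr P (\<lambda>z. d1 (rational_inner c m n) z w))"
  unfolding d1_def
proof (rule reflection_dirichlet_norm_sq_le_circle_norm[OF P_nonneg degree_slice_poly_le])
  show "norm (w ^ n) = 1" using circle by (simp add: norm_power)
  show "rational_inner c m n z w =
      w ^ n * poly (reflection m (slice_poly c m n w)) z / poly (slice_poly c m n w) z" for z
    by (simp add: rational_inner_def slice_poly_refl_coeff[OF circle] flip: poly_slice_poly)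
qed (simp add: poly_slice_poly nonzero)

lemma AE_d1_rational_inner_radial_limit:
  assumes "slice_poly c m n w \<noteq> 0"
  shows "AE s in angle_measure. ((\<lambda>r. d1 (rational_inner c m n) (of_real r * cis s) (of_real r * w)) \<longlongrightarrow>
    d1 (rational_inner c m n) (cis s) w) (at_left 1)"
proof (rule eventually_mono[OF AE_cis_poly_nonzero[OF assms]])
  fix s assume "poly (slice_poly c m n w) (cis s) \<noteq> 0"
  moreover have "((\<lambda>r. of_real r * z) \<longlongrightarrow> z) (at_left (1::real))" for z :: complex
    using tendsto_mult[OF tendsto_of_real[OF tendsto_ident_at[of "1::real"]] tendsto_const[of z]]
    by simp
  ultimately show "((\<lambda>r. d1 (rational_inner c m n) (of_real r * cis s) (of_real r * w)) \<longlongrightarrow>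
      d1 (rational_inner c m n) (cis s) w) (at_left 1)"
    by (intro tendsto_d1_rational_inner) (auto simp: poly_slice_poly)
qed

theorem dirichlet2_of_hardy2_d1:
  assumes no_zeros: "no_zeros_bidisc c m n" and atoral: "atoral c m n" and P_pos: "0 < P"
    and hardy: "hardy2 P (d1 (rational_inner c m n))"
  shows "dirichlet2 P 0 (rational_inner c m n)"
proof -
  let ?\<phi> = "rational_inner c m n" and ?C = "ennreal (blaschke_dirichlet_const P m)"
  note nonzero = atoral_bipoly_nonzero[OF no_zeros atoral]
    and radial_limit = AE_d1_rational_inner_radial_limit[OF atoral_slice_poly_nonzero[OF atoral norm_cis]]
  obtain g where boundary: "g \<in> borel_measurable torus_measure" "(\<integral>\<^sup>+x. g x \<partial>torus_measure) < \<infinity>"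
    "\<And>s t L. ((\<lambda>r. d1 ?\<phi> (of_real r * cis s) (of_real r * cis t)) \<longlongrightarrow> L) (at_left 1) \<Longrightarrow>
       g (s, t) = ennreal (norm L powr P)"
    using hardy2_radial_limit[OF hardy P_pos] by blast
  have "circle_norm_powr P (\<lambda>z. d1 ?\<phi> z (cis t)) = (\<integral>\<^sup>+s. g (s, t) \<partial>angle_measure)" for t
    unfolding circle_norm_powr_def
    by (intro nn_integral_cong_AE boundary(3)[symmetric] eventually_mono[OF radial_limit])
  then have "dirichlet_norm_sq P (\<lambda>z. ?\<phi> z (cis t)) \<le> ?C * (1 + (\<integral>\<^sup>+s. g (s, t) \<partial>angle_measure))" for t
    using rational_inner_slice_dirichlet_norm_sq_le[of P "cis t" c m n] P_pos nonzero by simp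
  then have "(\<integral>\<^sup>+t. dirichlet_norm_sq P (\<lambda>z. ?\<phi> z (cis t)) \<partial>angle_measure) \<le>
      (\<integral>\<^sup>+t. ?C * (1 + (\<integral>\<^sup>+s. g (s, t) \<partial>angle_measure)) \<partial>angle_measure)"
    by (rule nn_integral_mono)
  also have "\<dots> = ?C * (ennreal (2 * pi) + (\<integral>\<^sup>+x. g x \<partial>torus_measure))"
  proof -
    have meas: "(\<lambda>t. \<integral>\<^sup>+s. g (s, t) \<partial>angle_measure) \<in> borel_measurable angle_measure"
      using measurable_pair_swap[OF boundary(1)] by (rule angle.borel_measurable_nn_integral)
    show ?thesis
      unfolding nn_integral_cmult[OF borel_measurable_add[OF borel_measurable_const meas]]
        nn_integral_add[OF borel_measurable_const meas] torus.nn_integral_snd[OF boundary(1)]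
      by (simp add: emeasure_angle_measure)
  qed
  also have "\<dots> < \<infinity>" using boundary(2) by (simp add: ennreal_mult_less_top)
  finally show ?thesis
    using rational_inner_taylor_coeff_holomorphic[OF nonzero]
      dirichlet2_of_slices[OF holo_bidisc_rational_inner[OF no_zeros]] by metis
qed

subsection \<open>Exchanging the variables\<close>

lemma bipoly_swap: "bipoly (\<lambda>j k. c k j) n m w z = bipoly c m n z w"
  unfolding bipoly_def by (subst sum.swap) (simp add: mult_ac)

lemma refl_coeff_swap: "refl_coeff (\<lambda>j k. c k j) n m = (\<lambda>j k. refl_coeff c m n k j)"
  by (intro ext) (simp add: refl_coeff_def conj_commute)

lemma rational_inner_swap: "rational_inner (\<lambda>j k. c k j) n m = (\<lambda>w z. rational_inner c m n z w)"
  by (intro ext)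
     (simp only: rational_inner_def refl_coeff_swap[of c]
       bipoly_swap[of c] bipoly_swap[of "refl_coeff c m n"])

lemma is_polyfun_swap:
  assumes "is_polyfun f"
  shows "is_polyfun (\<lambda>z w. f w z)"
proof -
  obtain d N where "\<And>z w. f z w = bipoly d N N z w" using assms unfolding is_polyfun_def by blast
  then have "f w z = bipoly (\<lambda>j k. d k j) N N z w" for z w by (simp only: bipoly_swap[of d])
  then show ?thesis unfolding is_polyfun_def by blast
qed

lemma no_zeros_bidisc_swap: "no_zeros_bidisc c m n \<Longrightarrow> no_zeros_bidisc (\<lambda>j k. c k j) n m"
  by (simp add: no_zeros_bidisc_def bipoly_swap[of c])

lemma atoral_swap:
  assumes "atoral c m n"
  shows "atoral (\<lambda>j k. c k j) n m"
  unfolding atoral_def refl_coeff_swap[of c] bipoly_swap[of c] bipoly_swap[of "refl_coeff c m n"]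
proof clarify
  fix q r s
  assume polyfun: "is_polyfun q" "is_polyfun r" "is_polyfun s" and nonconst: "\<nexists>a. \<forall>z w. q z w = a"
    and factors: "\<forall>w z. bipoly c m n z w = q w z * r w z"
      "\<forall>w z. bipoly (refl_coeff c m n) m n z w = q w z * s w z"
  moreover have "\<nexists>a. \<forall>z w. q w z = a" using nonconst by blast
  ultimately show False
    using assms[unfolded atoral_def not_ex, THEN spec, THEN spec, THEN spec,
        of "\<lambda>z w. q w z" "\<lambda>z w. r w z" "\<lambda>z w. s w z"] polyfun[THEN is_polyfun_swap]
    by simp
qed

theorem theorem9p1:
  fixes c :: "nat \<Rightarrow> nat \<Rightarrow> complex" and m n :: nat and P :: real
  assumes "has_bidegree c m n"
    and "no_zeros_bidisc c m n"
    and "atoral c m n"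
    and "0 < P"
  defines "\<phi> \<equiv> (\<lambda>z1 z2. bipoly (refl_coeff c m n) m n z1 z2 / bipoly c m n z1 z2)"
  shows "(hardy2 P (d1 \<phi>) \<longrightarrow> dirichlet2 P 0 \<phi>) \<and> (hardy2 P (d2 \<phi>) \<longrightarrow> dirichlet2 0 P \<phi>)"
proof (intro conjI impI)
  have phi_eq: "\<phi> = rational_inner c m n"
    by (simp add: \<phi>_def rational_inner_def [abs_def])
  show "dirichlet2 P 0 \<phi>" if "hardy2 P (d1 \<phi>)"
    using dirichlet2_of_hardy2_d1[OF assms(2-4)] that by (simp add: phi_eq)
  show "dirichlet2 0 P \<phi>" if "hardy2 P (d2 \<phi>)"
  proof -
    let ?\<psi> = "rational_inner (\<lambda>j k. c k j) n m"
    have "d1 ?\<psi> = (\<lambda>w z. d2 \<phi> z w)"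
      by (simp add: fun_eq_iff d1_def d2_def rational_inner_swap[of c] phi_eq)
    then have "dirichlet2 P 0 ?\<psi>"
      using hardy2_swap[OF that \<open>0 < P\<close>]
      by (intro dirichlet2_of_hardy2_d1 no_zeros_bidisc_swap[OF assms(2)] atoral_swap[OF assms(3)])
         (simp_all add: assms(4))
    then show ?thesis using dirichlet2_swap[of P 0 ?\<psi>] by (simp add: rational_inner_swap[of c] phi_eq)
  qed
qed

end
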